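(* Let $(\mathfrak{X},\Gamma,\Phi)$ be a nilpotent Cantor action, with discriminant $\mathfrak{D}(\Phi)\subset\mathfrak{G}(\Phi)$. If the prime spectrum $\pi(\Pi[\mathfrak{D}(\Phi)])$ is finite, then the action is stable. In particular, if the prime spectrum $\pi(\Pi[\mathfrak{G}(\Phi)])$ is finite, then the action is stable.
   Context: A Cantor action $(\mathfrak{X}, \Gamma, \Phi)$ consists of a countable group $\Gamma$, a Cantor space $\mathfrak{X}$ and a minimal action $\Phi \colon \Gamma \times \mathfrak{X} \to \mathfrak{X}$ by homeomorphisms (every orbit is dense). It is equicontinuous if, for a metric $d_{\mathfrak{X}}$ compatible with the topology, for all $\varepsilon>0$ there is $\delta>0$ such that $d_{\mathfrak{X}}(x,y)<\delta$ implies $d_{\mathfrak{X}}(\gamma x,\gamma y)<\varepsilon$ for all $\gamma\in\Gamma$. A nilpotent Cantor action is a minimal equicontinuous Cantor action $(\mathfrak{X},\Gamma,\Phi)$ where $\Gamma$ contains a finitely generated nilpotent subgroup $\Gamma_0\subset\Gamma$ of finite index. For an equicontinuous Cantor action, $\mathfrak{G}(\Phi) = \overline{\Phi(\Gamma)} \subset \mathrm{Homeo}(\mathfrak{X})$ denotes the closure in the uniform topology, a profinite group acting on $\mathfrak{X}$; this action is denoted $\widehat\Phi$. The discriminant is the isotropy group $\mathfrak{D}(\Phi)=\mathfrak{D}(\Phi,x) = \{\widehat g \in \mathfrak{G}(\Phi) \mid \widehat g\, x = x\}$ for a basepoint $x\in\mathfrak{X}$ (its conjugacy class in $\mathfrak{G}(\Phi)$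 is independent of $x$). A Steinitz number is a formal product $\Pi=\prod_{p} p^{n(p)}$ over all primes, with $0 \leq n(p) \leq \infty$; $LCM$ of a collection takes the supremum of exponents at each prime. The prime spectrum of $\Pi$ is $\pi(\Pi)=\{p\mid n(p)>0\}$. With $\mathfrak{N}$ ranging over open normal subgroups of $\mathfrak{G}(\Phi)$, $\Pi[\mathfrak{G}(\Phi)] = LCM\{\#\, \mathfrak{G}(\Phi)/\mathfrak{N}\}$ and $\Pi[\mathfrak{D}(\Phi)] = LCM\{\#\, \mathfrak{D}(\Phi,x)/(\mathfrak{N}\cap\mathfrak{D}(\Phi,x))\}$. An action $\Psi\colon H\times\mathfrak{X}\to\mathfrak{X}$ of a topological group $H$ on a Cantor metric space $(\mathfrak{X},d_{\mathfrak{X}})$ is locally quasi-analytic if there exists $\varepsilon>0$ such that for any non-empty open set $U\subset\mathfrak{X}$ with $\mathrm{diam}(U)<\varepsilon$ and any non-empty open subset $V\subset U$: if $g\in H$ satisfies $\Psi(g)(V)=V$ and $\Psi(g)|V$ is the identity map on $V$, then $\Psi(g)$ acts as the identity on all of $U$. An equicontinuous Cantor action $(\mathfrak{X},\Gamma,\Phi)$ is stable if the induced action $\widehat\Phi\colon\mathfrak{G}(\Phi)\times\mathfrak{X}\to\mathfrak{X}$ is locally quasi-analytic. *)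

theory Defs
  imports
    "HOL-Analysis.Analysis"
    "HOL-Algebra.Generated_Groups"
    "HOL-Algebra.Group_Action"
    "HOL-Library.Extended_Nat"
    "HOL-Computational_Algebra.Primes"
begin

section \<open>Groups\<close>

text \<open>
  The terms of the lower central series: \<open>\<gamma>\<^sub>0 = G\<close> and
  \<open>\<gamma>\<^sub>n\<^sub>+\<^sub>1 = [\<gamma>\<^sub>n, G]\<close>, the subgroup generated by the commutators.
\<close>

primrec lower_central :: "('g, 'm) monoid_scheme \<Rightarrow> nat \<Rightarrow> 'g set" where
  "lower_central G 0 = carrier G"
| "lower_central G (Suc n) =
     generate G {a \<otimes>\<^bsub>G\<^esub> b \<otimes>\<^bsub>G\<^esub> inv\<^bsub>G\<^esub> a \<otimes>\<^bsub>G\<^esub> inv\<^bsub>G\<^esub> b |a b.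
                   a \<in> lower_central G n \<and> b \<in> carrier G}"

definition nilpotent_group :: "('g, 'm) monoid_scheme \<Rightarrow> bool" where
  "nilpotent_group G \<longleftrightarrow> group G \<and> (\<exists>n. lower_central G n = {\<one>\<^bsub>G\<^esub>})"

definition finitely_generated_group :: "('g, 'm) monoid_scheme \<Rightarrow> bool" where
  "finitely_generated_group G \<longleftrightarrow>
     group G \<and> (\<exists>S. finite S \<and> S \<subseteq> carrier G \<and> generate G S = carrier G)"

definition virtually_fg_nilpotent :: "('g, 'm) monoid_scheme \<Rightarrow> bool" where
  "virtually_fg_nilpotent G \<longleftrightarrow>
     (\<exists>H. subgroup H G \<and> finite (rcosets\<^bsub>G\<^esub> H) \<and>
          finitely_generated_group (G\<lparr>carrier := H\<rparr>) \<and> nilpotent_group (G\<lparr>carrier := H\<rparr>))"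


section \<open>Cantor actions\<close>

text \<open>
  The Cantor space is a type \<open>'x\<close> carrying a chosen compatible metric; it is
  automatically nonempty.
\<close>

definition cantor_space :: "'x::metric_space itself \<Rightarrow> bool" where
  "cantor_space _ \<longleftrightarrow>
     compact (UNIV :: 'x set) \<and>
     (\<forall>S :: 'x set. connected S \<longrightarrow> (\<exists>a. S \<subseteq> {a})) \<and>
     (\<forall>x :: 'x. x islimpt UNIV)"

definition Homeo :: "('x::metric_space \<Rightarrow> 'x) set" where
  "Homeo = {f. \<exists>g. homeomorphism UNIV UNIV f g}"

definition cantor_action ::
    "('g, 'm) monoid_scheme \<Rightarrow> ('g \<Rightarrow> 'x::metric_space \<Rightarrow> 'x) \<Rightarrow> bool" where
  "cantor_action G \<phi> \<longleftrightarrow>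
     countable (carrier G) \<and> cantor_space TYPE('x) \<and>
     group_action G UNIV \<phi> \<and> \<phi> ` carrier G \<subseteq> Homeo \<and>
     (\<forall>x. closure (Group_Action.orbit G \<phi> x) = UNIV)"

definition equicontinuous_action ::
    "('g, 'm) monoid_scheme \<Rightarrow> ('g \<Rightarrow> 'x::metric_space \<Rightarrow> 'x) \<Rightarrow> bool" where
  "equicontinuous_action G \<phi> \<longleftrightarrow>
     (\<forall>\<epsilon>>0. \<exists>\<delta>>0. \<forall>x y. dist x y < \<delta> \<longrightarrow>
        (\<forall>g\<in>carrier G. dist (\<phi> g x) (\<phi> g y) < \<epsilon>))"

definition nilpotent_cantor_action ::
    "('g, 'm) monoid_scheme \<Rightarrow> ('g \<Rightarrow> 'x::metric_space \<Rightarrow> 'x) \<Rightarrow> bool" where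
  "nilpotent_cantor_action G \<phi> \<longleftrightarrow>
     cantor_action G \<phi> \<and> equicontinuous_action G \<phi> \<and> virtually_fg_nilpotent G"


section \<open>The closure of the action and its discriminant\<close>

definition uniform_dist :: "('x::metric_space \<Rightarrow> 'x) \<Rightarrow> ('x \<Rightarrow> 'x) \<Rightarrow> real" where
  "uniform_dist f g = (SUP x. dist (f x) (g x))"

definition Homeo_topology :: "('x::metric_space \<Rightarrow> 'x) topology" where
  "Homeo_topology = Metric_space.mtopology Homeo uniform_dist"

text \<open>
  Outside the locale, \<open>Metric_space.mtopology\<close> is meaningful only for an actual
  metric; on a compact space this is the case.
\<close>

lemma Metric_space_Homeo:
  assumes "compact (UNIV :: 'x::metric_space set)"
  shows "Metric_space (Homeo :: ('x \<Rightarrow> 'x) set) uniform_dist"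
proof -
  obtain B where B: "\<And>x y :: 'x. dist x y \<le> B"
    using compact_imp_bounded[OF assms] by (metis UNIV_I bounded_two_points)
  have bdd: "bdd_above (range (\<lambda>x. dist (f x) (g x)))" for f g :: "'x \<Rightarrow> 'x"
    using B by (intro bdd_aboveI) auto
  have ub: "dist (f x) (g x) \<le> uniform_dist f g" for f g :: "'x \<Rightarrow> 'x" and x
    unfolding uniform_dist_def by (rule cSUP_upper[OF UNIV_I bdd])
  show ?thesis
  proof
    fix f g :: "'x \<Rightarrow> 'x"
    show "0 \<le> uniform_dist f g"
      using ub[of f undefined g] zero_le_dist order_trans by blast
    show "uniform_dist f g = uniform_dist g f"
      by (simp add: uniform_dist_def dist_commute)
    show "uniform_dist f g = 0 \<longleftrightarrow> f = g"
    proof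
      assume "uniform_dist f g = 0"
      then have "dist (f x) (g x) \<le> 0" for x using ub[of f x g] by simp
      then show "f = g" by (simp add: fun_eq_iff)
    qed (simp add: uniform_dist_def)
  next
    fix f g h :: "'x \<Rightarrow> 'x"
    have "dist (f x) (h x) \<le> uniform_dist f g + uniform_dist g h" for x
      using dist_triangle[of "f x" "h x" "g x"] ub[of f x g] ub[of g x h] by linarith
    then show "uniform_dist f h \<le> uniform_dist f g + uniform_dist g h"
      unfolding uniform_dist_def[of f h] by (intro cSUP_least) auto
  qed
qed

definition closure_group ::
    "('g, 'm) monoid_scheme \<Rightarrow> ('g \<Rightarrow> 'x::metric_space \<Rightarrow> 'x) \<Rightarrow> ('x \<Rightarrow> 'x) monoid" where
  "closure_group G \<phi> =
     (BijGroup UNIV)\<lparr>carrier := Homeo_topology closure_of (\<phi> ` carrier G)\<rparr>"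

definition closure_topology ::
    "('g, 'm) monoid_scheme \<Rightarrow> ('g \<Rightarrow> 'x::metric_space \<Rightarrow> 'x) \<Rightarrow> ('x \<Rightarrow> 'x) topology" where
  "closure_topology G \<phi> = subtopology Homeo_topology (carrier (closure_group G \<phi>))"

definition closure_action :: "('x \<Rightarrow> 'x) \<Rightarrow> 'x \<Rightarrow> 'x" where
  "closure_action f x = f x"

definition discriminant ::
    "('g, 'm) monoid_scheme \<Rightarrow> ('g \<Rightarrow> 'x::metric_space \<Rightarrow> 'x) \<Rightarrow> 'x \<Rightarrow> ('x \<Rightarrow> 'x) set" where
  "discriminant G \<phi> x = stabilizer (closure_group G \<phi>) closure_action x"

definition open_normal_subgroups ::
    "('g, 'm) monoid_scheme \<Rightarrow> ('g \<Rightarrow> 'x::metric_space \<Rightarrow> 'x) \<Rightarrow> ('x \<Rightarrow> 'x) set set" where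
  "open_normal_subgroups G \<phi> =
     {N. N \<lhd> closure_group G \<phi> \<and> openin (closure_topology G \<phi>) N}"


section \<open>Steinitz numbers\<close>

text \<open>
  A Steinitz number is represented by its exponent function; only the values at primes matter.
\<close>

type_synonym steinitz = "nat \<Rightarrow> enat"

definition steinitz_of_nat :: "nat \<Rightarrow> steinitz" where
  "steinitz_of_nat n p = (if prime p then enat (multiplicity p n) else 0)"

definition steinitz_LCM :: "steinitz set \<Rightarrow> steinitz" where
  "steinitz_LCM A p = (SUP a\<in>A. a p)"

definition prime_spectrum :: "steinitz \<Rightarrow> nat set" where
  "prime_spectrum a = {p. prime p \<and> a p > 0}"

text \<open>
  In the two Steinitz orders below, the quotients are finite for equicontinuous actions, since the
  closure group is then compact; so the convention that infinite sets have cardinality 0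
  plays no role.
\<close>

definition steinitz_closure_group ::
    "('g, 'm) monoid_scheme \<Rightarrow> ('g \<Rightarrow> 'x::metric_space \<Rightarrow> 'x) \<Rightarrow> steinitz" where
  "steinitz_closure_group G \<phi> =
     steinitz_LCM {steinitz_of_nat (Coset.order (closure_group G \<phi> Mod N)) |N.
                     N \<in> open_normal_subgroups G \<phi>}"

definition steinitz_discriminant ::
    "('g, 'm) monoid_scheme \<Rightarrow> ('g \<Rightarrow> 'x::metric_space \<Rightarrow> 'x) \<Rightarrow> 'x \<Rightarrow> steinitz" where
  "steinitz_discriminant G \<phi> x =
     (let D = discriminant G \<phi> x in
      steinitz_LCM {steinitz_of_nat
                      (Coset.order ((closure_group G \<phi>)\<lparr>carrier := D\<rparr> Mod (N \<inter> D))) |N.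
                     N \<in> open_normal_subgroups G \<phi>})"


section \<open>Stability\<close>

definition locally_quasi_analytic ::
    "('h, 'm) monoid_scheme \<Rightarrow> ('h \<Rightarrow> 'x::metric_space \<Rightarrow> 'x) \<Rightarrow> bool" where
  "locally_quasi_analytic H \<psi> \<longleftrightarrow>
     (\<exists>\<epsilon>>0. \<forall>U V. open U \<and> U \<noteq> {} \<and> diameter U < \<epsilon> \<and> open V \<and> V \<noteq> {} \<and> V \<subseteq> U \<longrightarrow>
        (\<forall>g\<in>carrier H. \<psi> g ` V = V \<and> (\<forall>x\<in>V. \<psi> g x = x) \<longrightarrow> (\<forall>x\<in>U. \<psi> g x = x)))"

definition stable_action ::
    "('g, 'm) monoid_scheme \<Rightarrow> ('g \<Rightarrow> 'x::metric_space \<Rightarrow> 'x) \<Rightarrow> bool" where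
  "stable_action G \<phi> \<longleftrightarrow> locally_quasi_analytic (closure_group G \<phi>) closure_action"

end

theory Submission
  imports Defs "HOL-Algebra.Multiplicative_Group"
begin

text \<open>
  The closure group \<open>K\<close> is profinite, and acts transitively and equicontinuously, so the action is stable as soon as
  the pointwise stabilisers in \<open>K\<close> of the balls of radius \<open>1/(l+1)\<close> around the basepoint form an eventually constant
  sequence. These are closed subgroups of the discriminant, hence pro-\<open>P\<close> for the finite set \<open>P\<close> of primes of its
  spectrum. A finitely generated nilpotent group is polycyclic, so up to finite index \<open>K\<close> has a finite series of closed
  subgroups with procyclic quotients, and it suffices that an ascending chain of closed pro-\<open>P\<close> subgroups of
  a procyclic group is eventually constant. For one prime \<open>p\<close> this holds since a closed subgroup with nontrivial \<open>p\<close>-part has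
  finite index in the \<open>p\<close>-part of the whole group.
\<close>

section \<open>Indices in cyclic groups\<close>

text \<open>The delicate point is uniformity. A chain of closed subgroups is seen only through its
  images in the finite quotients \<open>K / N k\<close>, and stabilisation at each level
  \<open>k\<close>, or at each prime, would not by itself give one bound \<open>L\<close>. In a
  product of groups of p-adic integers over infinitely many primes a chain can grow forever, one
  prime at a time; this is why finiteness of \<open>P\<close> enters. No topological quotient is
  formed. A procyclic quotient \<open>cl S / cl M\<close> is replaced by its finite levels, the
  quotients of \<open>S (N k)\<close> by \<open>M (N k)\<close>; subgroups of these are recorded by
  their indices, and the statement on indices is pulled back by compactness, using that the terms of
  the chain are closed. Pro-\<open>P\<close> is encoded by exponents: for each \<open>k\<close>
  there is one \<open>q\<close> with all prime factors in \<open>P\<close> such that every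
  \<open>h [^] q\<close> lies in \<open>N k\<close>. This comes from Lagrange in a finite quotient
  and passes to subgroups at once.\<close>

lemma int_subgroup_generator:
  fixes I :: "int set"
  assumes diff: "\<And>m n. m \<in> I \<Longrightarrow> n \<in> I \<Longrightarrow> m - n \<in> I"
    and "c \<in> I" "c > 0"
  shows "\<exists>d::nat. d > 0 \<and> (\<forall>m. m \<in> I \<longleftrightarrow> int d dvd m)"
proof -
  define d where "d = (LEAST d::nat. d > 0 \<and> int d \<in> I)"
  have "nat c > 0 \<and> int (nat c) \<in> I" using assms by simp
  then have "d > 0 \<and> int d \<in> I"
    unfolding d_def by (rule LeastI)
  then have d: "d > 0" "int d \<in> I" by auto
  have d_le: "d \<le> e" if "e > 0" "int e \<in> I" for e
    unfolding d_def using that by (intro Least_le) blast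
  have zero: "0 \<in> I" using diff[OF d(2) d(2)] by simp
  have neg: "- m \<in> I" if "m \<in> I" for m using diff[OF zero that] by simp
  have add: "m + n \<in> I" if "m \<in> I" "n \<in> I" for m n using diff[OF that(1) neg[OF that(2)]] by simp
  have nat_mult: "int e * int d \<in> I" for e
    by (induction e) (simp_all add: zero d add distrib_right)
  have mult: "e * int d \<in> I" for e
    by (cases "e \<ge> 0") (use nat_mult[of "nat e"] neg[OF nat_mult[of "nat (- e)"]] in auto)
  have "int d dvd m" if "m \<in> I" for m
  proof -
    have "m mod int d = m - (m div int d) * int d" by (simp add: minus_div_mult_eq_mod)
    then have r: "m mod int d \<in> I" using diff[OF that mult] by simp
    have "m mod int d < int d" "m mod int d \<ge> 0" using d by simp_all
    then have "m mod int d = 0"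
      using d_le[of "nat (m mod int d)"] r by fastforce
    then show ?thesis by auto
  qed
  then show ?thesis using d mult by (metis dvdE mult.commute)
qed

text \<open>
  For subgroups of \<open>\<int>/n\<^sub>k\<close> of index \<open>i\<^sub>l\<^sub>k\<close>, increasing in \<open>l\<close> and compatible with the projections
  \<open>\<int>/n\<^sub>k\<^sub>' \<rightarrow> \<int>/n\<^sub>k\<close>: at a prime \<open>p\<close>, once some index differs \<open>p\<close>-adically from \<open>n\<^sub>k\<close>, all deeper indices
  have the same \<open>p\<close>-adic valuation.
\<close>

lemma index_family_stabilises:
  fixes i :: "nat \<Rightarrow> nat \<Rightarrow> nat" and n :: "nat \<Rightarrow> nat"
  assumes "finite P" and pos: "\<And>l k. i l k > 0" "\<And>k. n k > 0"
    and mono: "\<And>l l' k. l \<le> l' \<Longrightarrow> i l' k dvd i l k"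
    and gcd: "\<And>l k k'. k \<le> k' \<Longrightarrow> i l k = gcd (i l k') (n k)"
    and index: "\<And>l k. \<exists>q>0. (\<forall>p. prime p \<longrightarrow> p dvd q \<longrightarrow> p \<in> P) \<and> n k dvd i l k * q"
  shows "\<exists>L. \<forall>l\<ge>L. \<forall>k. i l k = i L k"
proof -
  have dvd: "i l k dvd n k" for l k
    using gcd[of k k l] by (metis gcd_dvd2 order_refl)
  have v_le: "multiplicity p (i l k) \<le> multiplicity p (n k)" for p l k
    using dvd pos(2) by (intro dvd_imp_multiplicity_le) auto
  have v_anti: "multiplicity p (i l' k) \<le> multiplicity p (i l k)" if "l \<le> l'" for p l l' k
    using mono[OF that] pos(1) by (metis dvd_imp_multiplicity_le neq0_conv)
  \<comment> \<open>At a prime, the \<open>gcd\<close> hypothesis is a truncation: level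
    \<open>k\<close> sees the valuation of level \<open>k'\<close>, capped at that of
    \<open>n k\<close>.\<close>
  have v_min: "multiplicity p (i l k) = min (multiplicity p (i l k')) (multiplicity p (n k))"
    if "k \<le> k'" "prime p" for p l k k'
    unfolding gcd[OF that(1), of l] using that pos 
    by (subst multiplicity_gcd) (auto simp: prime_imp_prime_elem)
  have prime_case: "\<exists>L. \<forall>l\<ge>L. \<forall>k. multiplicity p (i l k) = multiplicity p (i L k)" if p: "prime p" for p
  \<comment> \<open>Either every image is trivial at \<open>p\<close>, or some level
    \<open>k0\<close> detects a nontrivial \<open>p\<close>-part, and that level controls all
    others.\<close>
  proof (cases "\<forall>l k. multiplicity p (i l k) = multiplicity p (n k)")
    case False
    then obtain l0 k0 where lt: "multiplicity p (i l0 k0) < multiplicity p (n k0)"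
      using v_le by (metis le_neq_implies_less)
    define f where "f l = multiplicity p (i l k0)" for l
    \<comment> \<open>An antitone sequence of naturals is constant from where it attains its
      minimum.\<close>
    define m where "m = (LEAST m. \<exists>l\<ge>l0. f l = m)"
    have "\<exists>m. \<exists>l\<ge>l0. f l = m" by blast
    then have "\<exists>l\<ge>l0. f l = m" unfolding m_def by (rule LeastI_ex)
    then obtain L where L: "L \<ge> l0" "f L = m" by blast
    have fl: "f l = f L" if "l \<ge> L" for l
    proof -
      have "m \<le> f l" unfolding m_def using that L le_trans by (intro Least_le) blast
      moreover have "f l \<le> f L" unfolding f_def by (rule v_anti[OF that])
      ultimately show ?thesis using L by simp
    qed
    \<comment> \<open>Beyond \<open>k0\<close> the cap \<open>multiplicity p (n k0)\<close> is not
      reached, because \<open>f l\<close> stays below it, so truncation loses nothing. Hence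
      \<open>f l\<close> alone determines the valuations at every level.\<close>
    have eq: "multiplicity p (i l k) = (if k \<le> k0 then min (f l) (multiplicity p (n k)) else f l)"
      if "l \<ge> L" for l k
    proof (cases "k \<le> k0")
      case True
      then show ?thesis using v_min[OF True p] by (simp add: f_def)
    next
      case False
      have "f l < multiplicity p (n k0)"
        using v_anti[of l0 l p k0] that L lt by (simp add: f_def)
      moreover have "f l = min (multiplicity p (i l k)) (multiplicity p (n k0))"
        unfolding f_def using False by (intro v_min p) simp
      ultimately show ?thesis using False by simp
    qed
    show ?thesis
    proof (intro exI[of _ L] allI impI)
      fix l k assume "l \<ge> L"
      then show "multiplicity p (i l k) = multiplicity p (i L k)"
        using fl[of l] eq[of l k] eq[of L k] by simp
    qed
  qed auto
  have "\<forall>p. \<exists>L. prime p \<longrightarrow> (\<forall>l\<ge>L. \<forall>k. multiplicity p (i l k) = multiplicity p (i L k))"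
    using prime_case by blast
  then obtain Lp where Lp: "\<And>p l k. prime p \<Longrightarrow> l \<ge> Lp p \<Longrightarrow>
      multiplicity p (i l k) = multiplicity p (i (Lp p) k)" by metis
  \<comment> \<open>Finiteness of \<open>P\<close> is used here; the \<open>0\<close> keeps
    \<open>Max\<close> meaningful when \<open>P\<close> is empty.\<close>
  define L where "L = Max (insert 0 (Lp ` P))"
  have "i l k = i L k" if "l \<ge> L" for l k
  proof (rule multiplicity_eq_nat)
    fix p :: nat assume p: "prime p"
    show "multiplicity p (i l k) = multiplicity p (i L k)"
    proof (cases "p \<in> P")
      case True
      then have "Lp p \<le> L" unfolding L_def using \<open>finite P\<close> by (intro Max_ge) auto
      then show ?thesis using Lp[OF p, of l k] Lp[OF p, of L k] that by simp
    next
      case False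
      \<comment> \<open>Outside \<open>P\<close> the factor \<open>q\<close> contributes nothing, so
        \<open>n k dvd i l k * q\<close> forces the full valuation, whatever \<open>l\<close>
        is.\<close>
      have "multiplicity p (i l k) = multiplicity p (n k)" for l
      proof -
        obtain q where q: "q > 0" "\<And>p. prime p \<Longrightarrow> p dvd q \<Longrightarrow> p \<in> P" "n k dvd i l k * q"
          using index by metis
        have "\<not> p dvd q" using q(2)[OF p] False by blast
        then have "multiplicity p (i l k * q) = multiplicity p (i l k)"
          using pos(1)[of l k] q(1) p
          by (simp add: prime_elem_multiplicity_mult_distrib not_dvd_imp_multiplicity_0)
        moreover have "multiplicity p (n k) \<le> multiplicity p (i l k * q)"
          using q pos(1)[of l k] by (intro dvd_imp_multiplicity_le) auto
        ultimately show ?thesis using v_le[of p l k] by simp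
      qed
      then show ?thesis by simp
    qed
  qed (use pos in auto)
  then show ?thesis by blast
qed

lemma (in group) mult_inv_cancel [simp]:
  assumes "x \<in> carrier G" "y \<in> carrier G"
  shows "x \<otimes> (inv x \<otimes> y) = y" "inv x \<otimes> (x \<otimes> y) = y"
  using assms by (simp_all add: m_assoc[symmetric])

section \<open>Closed subgroups of profinite groups\<close>

text \<open>
  The \<open>N k\<close> play the role of a neighbourhood basis of the identity in a profinite group;
  \<open>cluster_point\<close> expresses compactness.
\<close>

locale compact_filtration = group K for K (structure) +
  fixes N :: "nat \<Rightarrow> 'a set"
  assumes normal_N: "\<And>k. N k \<lhd> K"
    and N_antimono: "\<And>k k'. k \<le> k' \<Longrightarrow> N k' \<subseteq> N k"
    and cluster_point: "\<And>g :: nat \<Rightarrow> 'a. range g \<subseteq> carrier K \<Longrightarrow>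
      \<exists>h\<in>carrier K. \<forall>k. \<exists>n\<ge>k. inv h \<otimes> g n \<in> N k"
begin

text \<open>Topological closure, with the cosets of the \<open>N k\<close> as basic
  neighbourhoods.\<close>

definition cl :: "'a set \<Rightarrow> 'a set" where
  "cl A = {g \<in> carrier K. \<forall>k. \<exists>a\<in>A. inv a \<otimes> g \<in> N k}"

lemma subgroup_N: "subgroup (N k) K"
  using normal_N by (simp add: normal_imp_subgroup)

lemma conj_N: "x \<in> carrier K \<Longrightarrow> u \<in> N k \<Longrightarrow> inv x \<otimes> u \<otimes> x \<in> N k"
  using normal_N normal.inv_op_closed1 by fastforce

lemma N_inv_swap:
  assumes "x \<in> carrier K" "y \<in> carrier K" "inv x \<otimes> y \<in> N k"
  shows "inv y \<otimes> x \<in> N k"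
proof -
  have "inv (inv x \<otimes> y) \<in> N k" using assms subgroup_N by (simp add: subgroup.m_inv_closed)
  then show ?thesis using assms by (simp add: inv_mult_group)
qed

lemma N_trans:
  assumes "x \<in> carrier K" "y \<in> carrier K" "z \<in> carrier K" "inv x \<otimes> y \<in> N k" "inv y \<otimes> z \<in> N k"
  shows "inv x \<otimes> z \<in> N k"
proof -
  have "(inv x \<otimes> y) \<otimes> (inv y \<otimes> z) \<in> N k" using assms subgroup_N by (simp add: subgroup.m_closed)
  moreover have "(inv x \<otimes> y) \<otimes> (inv y \<otimes> z) = inv x \<otimes> z" 
    using assms by (simp add: m_assoc)
  ultimately show ?thesis by simp
qed

text \<open>Two powers of \<open>t\<close> close to a common cluster point lie in one coset of
  \<open>N k\<close>; the difference of their exponents is the witness.\<close>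

lemma power_in_N:
  assumes t: "t \<in> carrier K"
  shows "\<exists>d::nat. d > 0 \<and> t [^] d \<in> N k"
proof -
  obtain h where h: "h \<in> carrier K" "\<And>k. \<exists>n\<ge>k. inv h \<otimes> t [^] (n::nat) \<in> N k"
    using cluster_point[of "\<lambda>n. t [^] n"] t by auto
  obtain n :: nat where n: "inv h \<otimes> t [^] n \<in> N k" using h by blast
  \<comment> \<open>The level \<open>max k (Suc n)\<close> serves twice: it makes \<open>n'\<close>
    larger than \<open>n\<close>, and its subgroup is contained in \<open>N k\<close>.\<close>
  obtain n' :: nat where n': "n' \<ge> max k (Suc n)" "inv h \<otimes> t [^] n' \<in> N (max k (Suc n))" using h by blast
  have "inv h \<otimes> t [^] n' \<in> N k" using n' N_antimono[of k "max k (Suc n)"] by auto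
  then have "inv (t [^] n) \<otimes> t [^] n' \<in> N k"
    using t by (intro N_trans[OF _ h(1) _ N_inv_swap[OF h(1) _ n]]) simp_all
  also have "t [^] n' = t [^] n \<otimes> t [^] (n' - n)" using n' t by (simp add: nat_pow_mult)
  finally have "t [^] (n' - n) \<in> N k" using t by simp
  then show ?thesis using n' by (intro exI[of _ "n' - n"]) auto
qed

text \<open>Representatives of infinitely many distinct cosets would have a cluster point, and two
  of them would then agree modulo \<open>N k\<close>.\<close>

lemma finite_cosets:
  assumes D: "subgroup D K"
  shows "finite (rcosets\<^bsub>K\<lparr>carrier := D\<rparr>\<^esub> (N k \<inter> D))"
proof (rule ccontr)
  let ?R = "rcosets\<^bsub>K\<lparr>carrier := D\<rparr>\<^esub> (N k \<inter> D)"
  assume "infinite ?R"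
  then obtain f :: "nat \<Rightarrow> 'a set" where f: "inj f" "range f \<subseteq> ?R"
    using infinite_countable_subset by blast
  have D_sub: "D \<subseteq> carrier K" using D subgroup.subset by blast
  have "\<forall>n. \<exists>g\<in>D. f n = (N k \<inter> D) #> g"
  proof
    fix n
    have "f n \<in> ?R" using f(2) by blast
    then show "\<exists>g\<in>D. f n = (N k \<inter> D) #> g" by (auto simp: RCOSETS_def r_coset_def)
  qed
  then obtain g where g: "\<And>n. g n \<in> D" "\<And>n. f n = (N k \<inter> D) #> g n" by metis
  obtain h where h: "h \<in> carrier K" "\<And>k. \<exists>n\<ge>k. inv h \<otimes> g n \<in> N k"
    using cluster_point[of g] g(1) D_sub by blast
  obtain n where n: "inv h \<otimes> g n \<in> N k" using h by blast
  obtain n' where n': "n' \<ge> max k (Suc n)" "inv h \<otimes> g n' \<in> N (max k (Suc n))" using h by blast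
  have gK: "g n \<in> carrier K" "g n' \<in> carrier K" using g(1) D_sub by auto
  have "inv h \<otimes> g n' \<in> N k" using n' N_antimono[of k "max k (Suc n)"] by auto
  then have "inv (g n) \<otimes> g n' \<in> N k"
    by (rule N_trans[OF gK(1) h(1) gK(2) N_inv_swap[OF h(1) gK(1) n]])
  \<comment> \<open>Cluster points compare left cosets, \<open>rcosets\<close> are right cosets;
    normality converts one into the other.\<close>
  then have "g n \<otimes> (inv (g n) \<otimes> g n') \<otimes> inv (g n) \<in> N k"
    by (rule normal.inv_op_closed2[OF normal_N gK(1)])
  then have "g n' \<otimes> inv (g n) \<in> N k \<inter> D"
    using gK subgroup.m_closed[OF D g(1) subgroup.m_inv_closed[OF D g(1)]] by simp
  moreover have "g n' = (g n' \<otimes> inv (g n)) \<otimes> g n" using gK by (simp add: m_assoc)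
  ultimately have "g n' \<in> (N k \<inter> D) #> g n" unfolding r_coset_def by blast
  then have "(N k \<inter> D) #> g n = (N k \<inter> D) #> g n'"
    using gK subgroups_Inter_pair[OF subgroup_N D] by (intro repr_independence)
  then have "f n = f n'" by (simp add: g(2))
  then have "n = n'" using f(1) by (simp add: inj_eq)
  then show False using n'(1) by simp
qed

text \<open>
  The images of the \<open>A l\<close> in the cyclic quotients \<open>B k / B' k\<close> are determined by their indices, and
  stabilise uniformly in \<open>k\<close> because only primes in \<open>P\<close> are involved.
\<close>

lemma chain_stabilises_cyclic_extension:
  fixes A B B' :: "nat \<Rightarrow> 'a set"
  assumes subA: "\<And>l. subgroup (A l) K" and monoA: "\<And>l l'. l \<le> l' \<Longrightarrow> A l \<subseteq> A l'"
    and closedA: "\<And>l. cl (A l) \<subseteq> A l"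
    and subB: "\<And>k. subgroup (B k) K" "\<And>k. subgroup (B' k) K"
    and NB': "\<And>k. N k \<subseteq> B' k" and B'B: "\<And>k. B' k \<subseteq> B k"
    and B'_antimono: "\<And>k k'. k \<le> k' \<Longrightarrow> B' k' \<subseteq> B' k"
    and conj: "\<And>k x u. x \<in> B k \<Longrightarrow> u \<in> B' k \<Longrightarrow> inv x \<otimes> u \<otimes> x \<in> B' k"
    and t: "\<And>k. t \<in> B k"
    and cyclic: "\<And>k x. x \<in> B k \<Longrightarrow> \<exists>m::int. inv (t [^] m) \<otimes> x \<in> B' k"
    and AB: "\<And>l k. A l \<subseteq> B k"
    and "finite P"
    and spectrum: "\<And>k. \<exists>q>0. (\<forall>p. prime p \<longrightarrow> p dvd q \<longrightarrow> p \<in> P) \<and> (\<forall>l. \<forall>h\<in>A l. h [^] (q::nat) \<in> N k)"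
    and kernel: "\<And>l. l \<ge> Lk \<Longrightarrow> A l \<inter> (\<Inter>k. B' k) \<subseteq> A Lk"
  shows "\<exists>L. \<forall>l\<ge>L. A l \<subseteq> A L"
proof -
  have AK: "h \<in> carrier K" if "h \<in> A l" for h l using subA that subgroup.mem_carrier by metis
  have BK: "h \<in> carrier K" if "h \<in> B k" for h k using subB(1) that subgroup.mem_carrier by metis
  have B'K: "h \<in> carrier K" if "h \<in> B' k" for h k using subB(2) that subgroup.mem_carrier by metis
  have tK: "t \<in> carrier K" using t BK by blast
  \<comment> \<open>\<open>E l k\<close> is the product of \<open>A l\<close> and
    \<open>B' k\<close>. The exponents of \<open>t\<close> landing in it form a subgroup of the
    integers, and its generator \<open>i l k\<close> below is the index of the image of
    \<open>A l\<close> in the cyclic group \<open>B k / B' k\<close> of order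
    \<open>n k\<close>.\<close>
  define E where "E l k = {x \<in> carrier K. \<exists>h\<in>A l. inv h \<otimes> x \<in> B' k}" for l k
  define I where "I l k = {m::int. t [^] m \<in> E l k}" for l k
  define J where "J k = {m::int. t [^] m \<in> B' k}" for k
  \<comment> \<open>As \<open>A l\<close> lies in \<open>B k\<close>, it normalises
    \<open>B' k\<close>; so the product is closed under \<open>inv x \<otimes> y\<close>.\<close>
  have E_diff: "inv x \<otimes> y \<in> E l k" if xE: "x \<in> E l k" and yE: "y \<in> E l k" for x y l k
  proof -
    obtain g h where g: "g \<in> A l" "inv g \<otimes> x \<in> B' k" and h: "h \<in> A l" "inv h \<otimes> y \<in> B' k"
      and xy: "x \<in> carrier K" "y \<in> carrier K" using xE yE unfolding E_def by blast
    have ghK: "g \<in> carrier K" "h \<in> carrier K" using AK g h by auto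
    have gh: "inv g \<otimes> h \<in> A l" using subA g h by (simp add: subgroup.m_closed subgroup.m_inv_closed)
    have "inv (inv g \<otimes> x) \<in> B' k" using subB(2) g by (simp add: subgroup.m_inv_closed)
    then have "inv (inv g \<otimes> h) \<otimes> inv (inv g \<otimes> x) \<otimes> (inv g \<otimes> h) \<in> B' k"
      using conj gh AB by blast
    then have "inv (inv g \<otimes> h) \<otimes> inv (inv g \<otimes> x) \<otimes> (inv g \<otimes> h) \<otimes> (inv h \<otimes> y) \<in> B' k"
      using h subB(2) by (simp add: subgroup.m_closed)
    also have "inv (inv g \<otimes> h) \<otimes> inv (inv g \<otimes> x) \<otimes> (inv g \<otimes> h) \<otimes> (inv h \<otimes> y)
      = inv (inv g \<otimes> h) \<otimes> (inv x \<otimes> y)"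
      using ghK xy by (simp add: inv_mult_group m_assoc)
    finally show ?thesis unfolding E_def using gh xy by blast
  qed
  have I_diff: "m - n \<in> I l k" if "m \<in> I l k" "n \<in> I l k" for m n l k
  proof -
    have "t [^] (m - n) = inv (t [^] n) \<otimes> t [^] m"
      using int_pow_mult[OF tK, of "-n" m] int_pow_neg[OF tK, of n] by simp
    then show ?thesis using E_diff that unfolding I_def by simp
  qed
  have J_diff: "m - n \<in> J k" if "m \<in> J k" "n \<in> J k" for m n k
    using that subB(2) int_pow_diff[OF tK] unfolding J_def
    by (simp add: subgroup.m_closed subgroup.m_inv_closed)
  have B'E: "B' k \<subseteq> E l k" for l k
    unfolding E_def using subA B'K by (auto intro!: bexI[of _ \<one>] simp: subgroup.one_closed)
  have JI: "J k \<subseteq> I l k" for l k using B'E unfolding I_def J_def by blast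
  have pos: "\<exists>d::nat. d > 0 \<and> int d \<in> J k" for k
    using power_in_N[OF tK, of k] NB' unfolding J_def by (auto simp: int_pow_int)
  have "\<exists>d::nat. d > 0 \<and> (\<forall>m. m \<in> J k \<longleftrightarrow> int d dvd m)" for k
    using pos[of k] int_subgroup_generator[of "J k", OF J_diff] by auto
  then obtain n where n_pos: "\<And>k. n k > 0" and n: "\<And>k m. m \<in> J k \<longleftrightarrow> int (n k) dvd m" by metis
  have "\<exists>d::nat. d > 0 \<and> (\<forall>m. m \<in> I l k \<longleftrightarrow> int d dvd m)" for l k
    using pos[of k] int_subgroup_generator[of "I l k", OF I_diff] JI by fastforce
  then obtain i where i_pos: "\<And>l k. i l k > 0" and i: "\<And>l k m. m \<in> I l k \<longleftrightarrow> int (i l k) dvd m"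
    by metis
  have i_dvd: "i l k dvd i l' k'" if "I l' k' \<subseteq> I l k" for l k l' k'
    using that i by (metis dvd_refl int_dvd_int_iff subsetD)
  have index_stable: "\<exists>L. \<forall>l\<ge>L. \<forall>k. i l k = i L k"
  proof (rule index_family_stabilises)
    show "i l' k dvd i l k" if "l \<le> l'" for l l' k
      using monoA[OF that] by (intro i_dvd) (auto simp: I_def E_def)
    \<comment> \<open>For the hard divisibility, an \<open>h\<close> in \<open>A l\<close> that
      represents \<open>t [^] int (i l k)\<close> modulo \<open>B' k\<close> is written as
      \<open>t [^] m\<close> modulo the deeper \<open>B' k'\<close>. Then \<open>i l k'\<close>
      divides \<open>m\<close>, and \<open>m\<close> agrees with \<open>i l k\<close> modulo
      \<open>n k\<close>.\<close>
    show "i l k = gcd (i l k') (n k)" if "k \<le> k'" for l k k'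
    proof (rule dvd_antisym)
      have "i l k dvd i l k'"
        using B'_antimono[OF that] by (intro i_dvd) (auto simp: I_def E_def)
      moreover have "i l k dvd n k" using JI i n by (metis dvd_refl int_dvd_int_iff subsetD)
      ultimately show "i l k dvd gcd (i l k') (n k)" by simp
      have "t [^] int (i l k) \<in> E l k" using i I_def by (metis dvd_refl mem_Collect_eq)
      then obtain h where h: "h \<in> A l" "inv h \<otimes> t [^] int (i l k) \<in> B' k" by (auto simp: E_def)
      obtain m :: int where m: "inv (t [^] m) \<otimes> h \<in> B' k'" using cyclic[of h k'] AB h by blast
      have hK: "h \<in> carrier K" using AK h by blast
      have "inv (inv (t [^] m) \<otimes> h) \<in> B' k'" using subB(2) m by (simp add: subgroup.m_inv_closed)
      then have "inv h \<otimes> t [^] m \<in> B' k'" using hK tK by (simp add: inv_mult_group)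
      then have "m \<in> I l k'" unfolding I_def E_def using h tK by auto
      then have m1: "int (i l k') dvd m" using i by blast
      have "(inv (t [^] m) \<otimes> h) \<otimes> (inv h \<otimes> t [^] int (i l k)) \<in> B' k"
        using m h subB(2) B'_antimono[OF that] by (auto intro: subgroup.m_closed)
      also have "(inv (t [^] m) \<otimes> h) \<otimes> (inv h \<otimes> t [^] int (i l k)) = inv (t [^] m) \<otimes> t [^] int (i l k)"
        using hK tK by (simp add: m_assoc)
      also have "\<dots> = t [^] (- m + int (i l k))"
        using tK by (simp only: int_pow_mult int_pow_neg)
      finally have "int (n k) dvd - m + int (i l k)" using n J_def by blast
      then have "gcd (int (i l k')) (int (n k)) dvd (- m + int (i l k)) + m"
        using m1 by (intro dvd_add[OF dvd_trans[OF gcd_dvd2] dvd_trans[OF gcd_dvd1]])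
      then show "gcd (i l k') (n k) dvd i l k"
        by (metis add.commute add_minus_cancel gcd_int_int_eq int_dvd_int_iff)
    qed
    show "\<exists>q>0. (\<forall>p. prime p \<longrightarrow> p dvd q \<longrightarrow> p \<in> P) \<and> n k dvd i l k * q" for l k
    proof -
      obtain q where q: "q > 0" "\<forall>p. prime p \<longrightarrow> p dvd q \<longrightarrow> p \<in> P" "\<forall>l. \<forall>h\<in>A l. h [^] (q::nat) \<in> N k"
        using spectrum[of k] by blast
      define s where "s = t [^] int (i l k)"
      have "s \<in> E l k" unfolding s_def using i I_def by (metis dvd_refl mem_Collect_eq)
      then obtain h where h: "h \<in> A l" "inv h \<otimes> s \<in> B' k" and sK: "s \<in> carrier K" by (auto simp: E_def)
      have hK: "h \<in> carrier K" using AK h by blast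
      \<comment> \<open>The congruence of \<open>s\<close> and \<open>h\<close> modulo
        \<open>B' k\<close> survives powers because \<open>h\<close> normalises \<open>B' k\<close>.
        As \<open>h [^] q\<close> lies in \<open>N k\<close>, the power \<open>s [^] q\<close> then
        lies in \<open>B' k\<close>.\<close>
      have pow: "inv (h [^] e) \<otimes> s [^] e \<in> B' k" for e :: nat
      proof (induction e)
        case 0
        then show ?case using subB(2) by (simp add: subgroup.one_closed)
      next
        case (Suc e)
        have "inv h \<otimes> (inv (h [^] e) \<otimes> s [^] e) \<otimes> h \<in> B' k" using conj Suc h AB by blast
        then have "inv h \<otimes> (inv (h [^] e) \<otimes> s [^] e) \<otimes> h \<otimes> (inv h \<otimes> s) \<in> B' k"
          using subB(2) h by (simp add: subgroup.m_closed)
        also have "inv h \<otimes> (inv (h [^] e) \<otimes> s [^] e) \<otimes> h \<otimes> (inv h \<otimes> s) = inv (h [^] Suc e) \<otimes> s [^] Suc e"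
          using hK sK by (simp add: inv_mult_group m_assoc)
        finally show ?case .
      qed
      have "h [^] q \<in> B' k" using q(3) h NB' by blast
      then have "h [^] q \<otimes> (inv (h [^] q) \<otimes> s [^] q) \<in> B' k"
        using subB(2) pow by (simp add: subgroup.m_closed)
      then have "s [^] q \<in> B' k" using hK sK by simp
      moreover have "s [^] q = t [^] (int (i l k) * int q)"
        unfolding s_def using tK int_pow_pow[of t "int (i l k)" "int q"] by (simp add: int_pow_int)
      ultimately have "int (n k) dvd int (i l k) * int q" using n J_def by simp
      then have "n k dvd i l k * q" by (metis int_dvd_int_iff of_nat_mult)
      then show ?thesis using q by blast
    qed
  qed (use \<open>finite P\<close> i_pos n_pos in auto)
  then obtain L1 where L1: "\<And>l k. l \<ge> L1 \<Longrightarrow> i l k = i L1 k" by blast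
  \<comment> \<open>\<open>L1\<close> freezes the images modulo all \<open>B' k\<close> at once,
    \<open>Lk\<close> the intersection with the common kernel.\<close>
  define L where "L = max Lk L1"
  have E_eq: "A l \<subseteq> E L k" if "l \<ge> L" for l k
  proof
    fix b assume b: "b \<in> A l"
    then have bK: "b \<in> carrier K" using AK by blast
    obtain m :: int where m: "inv (t [^] m) \<otimes> b \<in> B' k" using cyclic AB b by blast
    have "inv (inv (t [^] m) \<otimes> b) \<in> B' k" using subB(2) m by (simp add: subgroup.m_inv_closed)
    then have "inv b \<otimes> t [^] m \<in> B' k" using bK tK by (simp add: inv_mult_group)
    then have "m \<in> I l k" unfolding I_def E_def using b tK by auto
    then have "m \<in> I L k" using i L1[of l k] L1[of L k] that by (simp add: L_def)
    then obtain h where h: "h \<in> A L" "inv h \<otimes> t [^] m \<in> B' k" by (auto simp: I_def E_def)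
    then have "(inv h \<otimes> t [^] m) \<otimes> (inv (t [^] m) \<otimes> b) \<in> B' k" using subB(2) m by (simp add: subgroup.m_closed)
    also have "(inv h \<otimes> t [^] m) \<otimes> (inv (t [^] m) \<otimes> b) = inv h \<otimes> b"
      using AK[OF h(1)] tK bK by (simp add: m_assoc)
    finally show "b \<in> E L k" unfolding E_def using h bK by blast
  qed
  have "A l \<subseteq> A L" if l: "l \<ge> L" for l
  proof
    fix b assume b: "b \<in> A l"
    then have bK: "b \<in> carrier K" using AK by blast
    have "\<forall>k. \<exists>h\<in>A L. inv h \<otimes> b \<in> B' k" using E_eq[OF l] b unfolding E_def by blast
    \<comment> \<open>The approximation \<open>h k\<close> of \<open>b\<close> depends on
      \<open>k\<close>. Compactness merges them into one \<open>z\<close>, which lies in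
      \<open>A L\<close> because \<open>A L\<close> is closed, and \<open>inv z \<otimes> b\<close>
      falls into every \<open>B' k\<close>.\<close>
    then obtain h where h: "\<And>k. h k \<in> A L" "\<And>k. inv (h k) \<otimes> b \<in> B' k" by metis
    obtain z where z: "z \<in> carrier K" "\<And>k. \<exists>n\<ge>k. inv z \<otimes> h n \<in> N k"
      using cluster_point[of h] h(1) AK by blast
    have "z \<in> cl (A L)"
      unfolding cl_def using z h(1) N_inv_swap AK by blast
    then have zA: "z \<in> A L" using closedA by blast
    have "inv z \<otimes> b \<in> B' k" for k
    proof -
      obtain n where n: "n \<ge> k" "inv z \<otimes> h n \<in> N k" using z by blast
      have "(inv z \<otimes> h n) \<otimes> (inv (h n) \<otimes> b) \<in> B' k"
        using n NB' h(2)[of n] B'_antimono[OF n(1)] by (blast intro: subgroup.m_closed[OF subB(2)])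
      also have "(inv z \<otimes> h n) \<otimes> (inv (h n) \<otimes> b) = inv z \<otimes> b"
        using z(1) AK[OF h(1)] bK by (simp add: m_assoc)
      finally show ?thesis .
    qed
    moreover have "inv z \<otimes> b \<in> A l"
      using monoA[OF l] zA b subA by (auto intro: subgroup.m_closed subgroup.m_inv_closed)
    ultimately have "inv z \<otimes> b \<in> A Lk" using kernel[of l] l by (auto simp: L_def)
    then have "inv z \<otimes> b \<in> A L" using monoA[of Lk L] by (auto simp: L_def)
    then have "z \<otimes> (inv z \<otimes> b) \<in> A L" using zA subA by (simp add: subgroup.m_closed)
    then show "b \<in> A L" using z(1) bK by simp
  qed
  then show ?thesis by blast
qed

text \<open>The product of \<open>A\<close> with \<open>N k\<close>: an approximation from outside
  whose intersection over \<open>k\<close> is \<open>cl A\<close>.\<close>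

definition thicken :: "'a set \<Rightarrow> nat \<Rightarrow> 'a set" where
  "thicken A k = {x \<in> carrier K. \<exists>a\<in>A. inv a \<otimes> x \<in> N k}"

lemma cl_eq_Inter_thicken: "cl A = (\<Inter>k. thicken A k)"
  unfolding cl_def thicken_def by auto

lemma cong_mult:
  assumes "a \<in> carrier K" "b \<in> carrier K" "x \<in> carrier K" "y \<in> carrier K"
    and "inv a \<otimes> x \<in> N k" "inv b \<otimes> y \<in> N k"
  shows "inv (a \<otimes> b) \<otimes> (x \<otimes> y) \<in> N k"
proof -
  have "(inv b \<otimes> (inv a \<otimes> x) \<otimes> b) \<otimes> (inv b \<otimes> y) \<in> N k"
    by (intro subgroup.m_closed[OF subgroup_N] conj_N assms)
  then show ?thesis using assms by (simp add: m_assoc inv_mult_group)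
qed

lemma cong_inv:
  assumes "a \<in> carrier K" "x \<in> carrier K" "inv a \<otimes> x \<in> N k"
  shows "inv (inv a) \<otimes> inv x \<in> N k"
proof -
  have "a \<otimes> (inv x \<otimes> a) \<otimes> inv a \<in> N k"
    by (rule normal.inv_op_closed2[OF normal_N assms(1) N_inv_swap[OF assms]])
  then show ?thesis using assms by (simp add: m_assoc)
qed

lemma cong_refl: "x \<in> carrier K \<Longrightarrow> inv x \<otimes> x \<in> N k"
  using subgroup_N by (simp add: subgroup.one_closed)

lemma thicken_incl: "A \<subseteq> carrier K \<Longrightarrow> A \<subseteq> thicken A k"
  unfolding thicken_def using cong_refl by blast

lemma subgroup_thicken:
  assumes "subgroup A K"
  shows "subgroup (thicken A k) K"
proof (rule subgroupI)
  note sub = subgroup.m_closed[OF assms] subgroup.m_inv_closed[OF assms] subgroup.mem_carrier[OF assms]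
  show "thicken A k \<subseteq> carrier K" by (auto simp: thicken_def)
  show "thicken A k \<noteq> {}"
    using thicken_incl[of A k] subgroup.one_closed[OF assms] subgroup.subset[OF assms] by blast
  show "inv x \<in> thicken A k" if x: "x \<in> thicken A k" for x
  proof -
    obtain a where a: "a \<in> A" "inv a \<otimes> x \<in> N k" "x \<in> carrier K" using x unfolding thicken_def by blast
    then have "inv (inv a) \<otimes> inv x \<in> N k" using cong_inv[of a x k] sub by simp
    then show ?thesis unfolding thicken_def using a sub by blast
  qed
  show "x \<otimes> y \<in> thicken A k" if x: "x \<in> thicken A k" and y: "y \<in> thicken A k" for x y
  proof -
    obtain a where a: "a \<in> A" "inv a \<otimes> x \<in> N k" "x \<in> carrier K" using x unfolding thicken_def by blast
    obtain b where b: "b \<in> A" "inv b \<otimes> y \<in> N k" "y \<in> carrier K" using y unfolding thicken_def by blast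
    have "inv (a \<otimes> b) \<otimes> (x \<otimes> y) \<in> N k" using a b cong_mult[of a b x y k] sub by simp
    then show ?thesis unfolding thicken_def using a b sub by blast
  qed
qed

lemma subgroup_cl: "subgroup A K \<Longrightarrow> subgroup (cl A) K"
  unfolding cl_eq_Inter_thicken by (intro subgroups_Inter) (auto intro: subgroup_thicken)

lemma cl_mono: "A \<subseteq> B \<Longrightarrow> cl A \<subseteq> cl B"
  unfolding cl_def by blast

lemma cl_cl:
  assumes "A \<subseteq> carrier K"
  shows "cl (cl A) \<subseteq> cl A"
proof
  fix g assume g: "g \<in> cl (cl A)"
  have "\<exists>a\<in>A. inv a \<otimes> g \<in> N k" for k
  proof -
    obtain b where b: "b \<in> cl A" "inv b \<otimes> g \<in> N k" using g unfolding cl_def[of "cl A"] by blast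
    then obtain a where a: "a \<in> A" "inv a \<otimes> b \<in> N k" unfolding cl_def by blast
    then show ?thesis using N_trans[of a b g k] b g assms unfolding cl_def by blast
  qed
  then show "g \<in> cl A" using g unfolding cl_def by blast
qed

end

text \<open>Built from the bottom: \<open>M\<close> is normal in \<open>A\<close>, and
  \<open>t\<close> generates \<open>A / M\<close>. All terms live in the ambient group, so that
  images and closures can be taken term by term.\<close>

inductive polycyclic_subgroup :: "('a, 'm) monoid_scheme \<Rightarrow> 'a set \<Rightarrow> bool" for G (structure) where
  trivial: "polycyclic_subgroup G {\<one>}"
| cyclic_extension: "\<lbrakk>polycyclic_subgroup G M; subgroup M G; subgroup A G; M \<subseteq> A; t \<in> A;
    \<And>x u. x \<in> A \<Longrightarrow> u \<in> M \<Longrightarrow> inv x \<otimes> u \<otimes> x \<in> M;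
    \<And>x. x \<in> A \<Longrightarrow> \<exists>m::int. inv (t [^] m) \<otimes> x \<in> M\<rbrakk> \<Longrightarrow> polycyclic_subgroup G A"

text \<open>Serves to carry the series of the discrete group into the closure group, although the
  action may have a kernel.\<close>

lemma (in group_hom) polycyclic_subgroup_image:
  assumes "polycyclic_subgroup G A"
  shows "polycyclic_subgroup H (h ` A)"
  using assms
proof induction
  case trivial
  then show ?case by (simp add: polycyclic_subgroup.trivial)
next
  case (cyclic_extension M A t)
  have AG: "x \<in> carrier G" if "x \<in> A" for x using that cyclic_extension.hyps subgroup.mem_carrier by metis
  have MG: "x \<in> carrier G" if "x \<in> M" for x using that cyclic_extension.hyps subgroup.mem_carrier by metis
  show ?case
  proof (rule polycyclic_subgroup.cyclic_extension[where M = "h ` M" and t = "h t"])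
    show "inv\<^bsub>H\<^esub> x \<otimes>\<^bsub>H\<^esub> u \<otimes>\<^bsub>H\<^esub> x \<in> h ` M" if xu: "x \<in> h ` A" "u \<in> h ` M" for x u
    proof -
      obtain y v where yv: "y \<in> A" "x = h y" "v \<in> M" "u = h v" using xu by blast
      then have "inv\<^bsub>H\<^esub> x \<otimes>\<^bsub>H\<^esub> u \<otimes>\<^bsub>H\<^esub> x = h (inv y \<otimes> v \<otimes> y)" using AG MG by simp
      then show ?thesis using cyclic_extension.hyps yv by blast
    qed
    show "\<exists>m::int. inv\<^bsub>H\<^esub> (h t [^]\<^bsub>H\<^esub> m) \<otimes>\<^bsub>H\<^esub> x \<in> h ` M" if x: "x \<in> h ` A" for x
    proof -
      obtain y where y: "y \<in> A" "x = h y" using x by blast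
      then obtain m :: int where m: "inv (t [^] m) \<otimes> y \<in> M" using cyclic_extension.hyps by blast
      have "inv\<^bsub>H\<^esub> (h t [^]\<^bsub>H\<^esub> m) \<otimes>\<^bsub>H\<^esub> x = h (inv (t [^] m) \<otimes> y)"
        using AG y cyclic_extension.hyps by (simp add: hom_int_pow)
      then show ?thesis using m by blast
    qed
  qed (use cyclic_extension subgroup_img_is_subgroup in auto)
qed

section \<open>Ascending chains of closed pro-\<open>P\<close> subgroups\<close>

context compact_filtration
begin

text \<open>One exponent \<open>q\<close> per level serves all \<open>l\<close>. Bounding exponents
  rather than orders lets the condition pass to subgroups with the same \<open>q\<close>.\<close>

definition pro_P_chain :: "nat set \<Rightarrow> (nat \<Rightarrow> 'a set) \<Rightarrow> bool" where
  "pro_P_chain P A \<longleftrightarrow> (\<forall>l. subgroup (A l) K \<and> cl (A l) \<subseteq> A l) \<and> mono A \<and>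
     (\<forall>k. \<exists>q>0. (\<forall>p. prime p \<longrightarrow> p dvd q \<longrightarrow> p \<in> P) \<and> (\<forall>l. \<forall>h\<in>A l. h [^] (q::nat) \<in> N k))"

lemma pro_P_chainD:
  assumes "pro_P_chain P A"
  shows "subgroup (A l) K" "cl (A l) \<subseteq> A l" "mono A"
    "\<exists>q>0. (\<forall>p. prime p \<longrightarrow> p dvd q \<longrightarrow> p \<in> P) \<and> (\<forall>l. \<forall>h\<in>A l. h [^] (q::nat) \<in> N k)"
  using assms unfolding pro_P_chain_def by simp_all

lemma pro_P_chain_Int:
  assumes A: "pro_P_chain P A" and S: "subgroup S K"
  shows "pro_P_chain P (\<lambda>l. A l \<inter> cl S)"
  unfolding pro_P_chain_def
proof (intro conjI allI)
  fix l
  show "subgroup (A l \<inter> cl S) K"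
    by (rule subgroups_Inter_pair[OF pro_P_chainD(1)[OF A] subgroup_cl[OF S]])
  have "cl (A l \<inter> cl S) \<subseteq> cl (A l)" "cl (A l \<inter> cl S) \<subseteq> cl (cl S)" by (intro cl_mono; blast)+
  then show "cl (A l \<inter> cl S) \<subseteq> A l \<inter> cl S"
    using cl_cl[OF subgroup.subset[OF S]] pro_P_chainD(2)[OF A, of l] by blast
next
  show "mono (\<lambda>l. A l \<inter> cl S)"
    using pro_P_chainD(3)[OF A] unfolding mono_def by blast
next
  fix k
  obtain q :: nat where "q > 0" "\<forall>p. prime p \<longrightarrow> p dvd q \<longrightarrow> p \<in> P" "\<forall>l. \<forall>h\<in>A l. h [^] q \<in> N k"
    using pro_P_chainD(4)[OF A, of k] by blast
  then show "\<exists>q>0. (\<forall>p. prime p \<longrightarrow> p dvd q \<longrightarrow> p \<in> P) \<and> (\<forall>l. \<forall>h\<in>A l \<inter> cl S. h [^] (q::nat) \<in> N k)"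
    by (intro exI[of _ q]) auto
qed

text \<open>Induction along the series, for all chains simultaneously: the hypothesis for
  \<open>M\<close> applies to the traces \<open>A l \<inter> cl M\<close>, and the cyclic quotient
  accounts for what remains.\<close>

lemma polycyclic_pro_P_chain_stabilises:
  assumes "polycyclic_subgroup K S" "finite P"
    and "pro_P_chain P A" "\<And>l. A l \<subseteq> cl S"
  shows "\<exists>L. \<forall>l\<ge>L. A l \<subseteq> A L"
  using assms(1,3,4)
proof (induction arbitrary: A)
  case trivial
  \<comment> \<open>Every closed subgroup contains \<open>cl {\<one>}\<close>, so this chain is
    constant.\<close>
  have "cl {\<one>} \<subseteq> A l" for l
    using cl_mono[of "{\<one>}" "A l"] subgroup.one_closed[OF pro_P_chainD(1)[OF trivial(1)], of l]
      pro_P_chainD(2)[OF trivial(1), of l] by simp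
  then show ?case using trivial(2) by blast
next
  case (cyclic_extension M S t)
  note chain = pro_P_chainD[OF cyclic_extension.prems(1)]
  obtain L0 where L0: "\<And>l. l \<ge> L0 \<Longrightarrow> A l \<inter> cl M \<subseteq> A L0 \<inter> cl M"
    using cyclic_extension.IH[OF pro_P_chain_Int[OF cyclic_extension.prems(1) cyclic_extension.hyps(2)]] by auto
  have SK: "x \<in> carrier K" if "x \<in> S" for x using that cyclic_extension.hyps(3) subgroup.mem_carrier by metis
  have MK: "x \<in> carrier K" if "x \<in> M" for x using that cyclic_extension.hyps(2) subgroup.mem_carrier by metis
  show ?case
  \<comment> \<open>The groups \<open>S\<close> and \<open>M\<close> need not contain
    \<open>N k\<close>, hence the thickening. The \<open>thicken M k\<close> intersect in
    \<open>cl M\<close>, so \<open>L0\<close> supplies the kernel hypothesis.\<close>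
  proof (rule chain_stabilises_cyclic_extension[where B = "thicken S" and B' = "thicken M" and t = t and Lk = L0 and P = P])
    show "N k \<subseteq> thicken M k" for k
      using subgroup.one_closed[OF cyclic_extension.hyps(2)] subgroup.mem_carrier[OF subgroup_N]
      unfolding thicken_def by (auto intro!: bexI[of _ \<one>])
    show "thicken M k \<subseteq> thicken S k" for k
      using cyclic_extension.hyps(4) unfolding thicken_def by blast
    show "thicken M k' \<subseteq> thicken M k" if "k \<le> k'" for k k'
      using N_antimono[OF that] unfolding thicken_def by blast
    show "t \<in> thicken S k" for k
      using thicken_incl[of S k] SK cyclic_extension.hyps(5) by blast
    show "A l \<subseteq> thicken S k" for l k
      using cyclic_extension.prems(2) unfolding cl_eq_Inter_thicken by blast
    show "A l \<inter> (\<Inter>k. thicken M k) \<subseteq> A L0" if "l \<ge> L0" for l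
      using L0[OF that] unfolding cl_eq_Inter_thicken by blast
    show "inv x \<otimes> u \<otimes> x \<in> thicken M k" if xu: "x \<in> thicken S k" "u \<in> thicken M k" for k x u
    proof -
      obtain a b where ab: "a \<in> S" "inv a \<otimes> x \<in> N k" "b \<in> M" "inv b \<otimes> u \<in> N k"
        and K: "x \<in> carrier K" "u \<in> carrier K" using xu unfolding thicken_def by blast
      have "inv (inv a \<otimes> b \<otimes> a) \<otimes> (inv x \<otimes> u \<otimes> x) \<in> N k"
        using ab K SK MK by (intro cong_mult cong_inv) auto
      then show ?thesis using cyclic_extension.hyps(6) ab K unfolding thicken_def by blast
    qed
    show "\<exists>m::int. inv (t [^] m) \<otimes> x \<in> thicken M k" if x: "x \<in> thicken S k" for k x
    proof -
      obtain a where a: "a \<in> S" "inv a \<otimes> x \<in> N k" and K: "x \<in> carrier K"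
        using x unfolding thicken_def by blast
      obtain m :: int where m: "inv (t [^] m) \<otimes> a \<in> M" using cyclic_extension.hyps(7) a by blast
      have tK: "t [^] m \<in> carrier K" using SK cyclic_extension.hyps(5) by simp
      have "inv (inv (t [^] m) \<otimes> a) \<otimes> (inv (t [^] m) \<otimes> x) \<in> N k"
        using a K SK tK cong_refl by (intro cong_mult) auto
      then show ?thesis using m tK K unfolding thicken_def by blast
    qed
    show "A l \<subseteq> A l'" if "l \<le> l'" for l l' using chain(3) that by (rule monoD)
  qed (use cyclic_extension.hyps subgroup_thicken assms(2) chain in auto)
qed

text \<open>Finitely many cosets of \<open>cl S\<close> cover \<open>K\<close>. Once the chain has
  met every coset it ever meets, a new element differs from an old one by an element of
  \<open>cl S\<close>, where the chain is already constant.\<close>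

lemma virtually_polycyclic_pro_P_chain_stabilises:
  assumes S: "polycyclic_subgroup K S" "subgroup S K" and "finite P" and chain: "pro_P_chain P A"
    and "finite R" and R: "R \<subseteq> carrier K" "\<And>x. x \<in> carrier K \<Longrightarrow> \<exists>r\<in>R. x \<otimes> inv r \<in> cl S"
  shows "\<exists>L. \<forall>l\<ge>L. A l \<subseteq> A L"
proof -
  note subA = pro_P_chainD(1)[OF chain]
  have monoA: "A l \<subseteq> A l'" if "l \<le> l'" for l l'
    using pro_P_chainD(3)[OF chain] that by (rule monoD)
  obtain L0 where L0: "\<And>l. l \<ge> L0 \<Longrightarrow> A l \<inter> cl S \<subseteq> A L0"
    using polycyclic_pro_P_chain_stabilises[OF S(1) \<open>finite P\<close> pro_P_chain_Int[OF chain S(2)]] by auto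
  \<comment> \<open>For a coset that no \<open>A l\<close> meets the value is arbitrary; including
    it in the maximum is harmless.\<close>
  define f where "f r = (SOME l. \<exists>a\<in>A l. a \<otimes> inv r \<in> cl S)" for r
  have f: "\<exists>a\<in>A (f r). a \<otimes> inv r \<in> cl S" if "a \<in> A l" "a \<otimes> inv r \<in> cl S" for r l a
    unfolding f_def by (rule someI2[of "\<lambda>l. \<exists>a\<in>A l. a \<otimes> inv r \<in> cl S" l]) (use that in blast)+
  define L where "L = Max (insert L0 (f ` R))"
  have L: "L0 \<le> L" "\<And>r. r \<in> R \<Longrightarrow> f r \<le> L" unfolding L_def using \<open>finite R\<close> by auto
  have "A l \<subseteq> A L" if l: "l \<ge> L" for l
  proof
    fix b assume b: "b \<in> A l"
    then have bK: "b \<in> carrier K" using subA subgroup.mem_carrier by metis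
    then obtain r where r: "r \<in> R" "b \<otimes> inv r \<in> cl S" using R by blast
    obtain a where "a \<in> A (f r)" and ar: "a \<otimes> inv r \<in> cl S" using f[OF b r(2)] by blast
    then have a: "a \<in> A L" using monoA[OF L(2)[OF r(1)]] by blast
    have aK: "a \<in> carrier K" using a subA subgroup.mem_carrier by metis
    have rK: "r \<in> carrier K" using R r by blast
    have "(b \<otimes> inv r) \<otimes> inv (a \<otimes> inv r) \<in> cl S"
      using subgroup_cl[OF S(2)] r(2) ar by (simp add: subgroup.m_closed subgroup.m_inv_closed)
    also have "(b \<otimes> inv r) \<otimes> inv (a \<otimes> inv r) = b \<otimes> inv a"
      using aK bK rK by (simp add: inv_mult_group m_assoc)
    finally have "b \<otimes> inv a \<in> cl S" .
    moreover have "b \<otimes> inv a \<in> A l"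
      using subA b a monoA[OF l] by (blast intro: subgroup.m_closed subgroup.m_inv_closed)
    ultimately have "b \<otimes> inv a \<in> A L" using L0[of l] l L(1) monoA[OF L(1)] by auto
    then have "b \<otimes> inv a \<otimes> a \<in> A L" using subA a by (simp add: subgroup.m_closed)
    then show "b \<in> A L" using aK bK by (simp add: m_assoc)
  qed
  then show ?thesis by blast
qed

end

section \<open>Finitely generated nilpotent groups\<close>

context group
begin

lemma inv_normalizes:
  assumes "subgroup M G" "subgroup A G" "\<And>x u. x \<in> A \<Longrightarrow> u \<in> M \<Longrightarrow> inv x \<otimes> u \<otimes> x \<in> M"
    and "x \<in> A" "u \<in> M"
  shows "x \<otimes> u \<otimes> inv x \<in> M"
  using assms(3)[OF subgroup.m_inv_closed[OF assms(2,4)] assms(5)] subgroup.mem_carrier[OF assms(2,4)] by simp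

text \<open>The set is the product of the powers of \<open>t\<close> with \<open>M\<close>, a
  subgroup because \<open>A\<close> normalises \<open>M\<close>. It serves to bound a group
  generated by \<open>t\<close> and \<open>M\<close>, whose elements thereby acquire an explicit
  power of \<open>t\<close>.\<close>

lemma subgroup_powers_times:
  assumes M: "subgroup M G" and A: "subgroup A G" and t: "t \<in> A"
    and conj: "\<And>x u. x \<in> A \<Longrightarrow> u \<in> M \<Longrightarrow> inv x \<otimes> u \<otimes> x \<in> M"
  shows "subgroup {x \<in> carrier G. \<exists>m::int. inv (t [^] m) \<otimes> x \<in> M} G"
proof (rule subgroupI)
  have tG: "t \<in> carrier G" using A t by (rule subgroup.mem_carrier)
  have tA: "t [^] m \<in> A" for m :: int using subgroup_int_pow_closed[OF A t] .
  let ?S = "{x \<in> carrier G. \<exists>m::int. inv (t [^] m) \<otimes> x \<in> M}"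
  show "?S \<subseteq> carrier G" by blast
  have "\<one> \<in> ?S" using subgroup.one_closed[OF M] by (auto intro!: exI[of _ 0])
  then show "?S \<noteq> {}" by blast
  show "inv x \<in> ?S" if x: "x \<in> ?S" for x
  proof -
    obtain m :: int where m: "inv (t [^] m) \<otimes> x \<in> M" and xG: "x \<in> carrier G" using x by blast
    have "t [^] m \<otimes> inv (inv (t [^] m) \<otimes> x) \<otimes> inv (t [^] m) \<in> M"
      using inv_normalizes[OF M A conj tA subgroup.m_inv_closed[OF M m]] .
    then have "inv (t [^] (- m)) \<otimes> inv x \<in> M"
      using tG xG by (simp add: inv_mult_group m_assoc int_pow_neg)
    then show ?thesis using xG by blast
  qed
  show "x \<otimes> y \<in> ?S" if x: "x \<in> ?S" and y: "y \<in> ?S" for x y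
  proof -
    obtain m :: int where m: "inv (t [^] m) \<otimes> x \<in> M" and xG: "x \<in> carrier G" using x by blast
    obtain n :: int where n: "inv (t [^] n) \<otimes> y \<in> M" and yG: "y \<in> carrier G" using y by blast
    have "(inv (t [^] n) \<otimes> (inv (t [^] m) \<otimes> x) \<otimes> t [^] n) \<otimes> (inv (t [^] n) \<otimes> y) \<in> M"
      using subgroup.m_closed[OF M conj[OF tA m] n] .
    then have "inv (t [^] (m + n)) \<otimes> (x \<otimes> y) \<in> M"
      using tG xG yG by (simp add: inv_mult_group m_assoc int_pow_mult)
    then show ?thesis using xG yG by blast
  qed
qed

lemma subgroup_lower_central: "subgroup (lower_central G n) G"
proof (induction n)
  case 0
  then show ?case by (simp add: subgroup_self)
next
  case (Suc n)
  then show ?case using subgroup.mem_carrier[OF Suc] by (auto intro!: generate_is_subgroup)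
qed

lemma commutator_lower_central:
  "a \<in> lower_central G n \<Longrightarrow> b \<in> carrier G \<Longrightarrow> a \<otimes> b \<otimes> inv a \<otimes> inv b \<in> lower_central G (Suc n)"
  by (auto intro: generate.incl)

lemma lower_central_carrier: "a \<in> lower_central G n \<Longrightarrow> a \<in> carrier G"
  using subgroup_lower_central by (rule subgroup.mem_carrier)

text \<open>The conjugate is \<open>u\<close> times the commutator of \<open>inv u\<close> and
  \<open>inv x\<close>, which lies in the next term of the series. So every subgroup between
  consecutive terms is normal in \<open>G\<close>.\<close>

lemma conj_between_lower_central:
  assumes M: "subgroup M G" "lower_central G (Suc n) \<subseteq> M" "M \<subseteq> lower_central G n"
    and "u \<in> M" "x \<in> carrier G"
  shows "inv x \<otimes> u \<otimes> x \<in> M"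
proof -
  have uG: "u \<in> carrier G" using M(1) \<open>u \<in> M\<close> by (rule subgroup.mem_carrier)
  have "inv u \<otimes> inv x \<otimes> inv (inv u) \<otimes> inv (inv x) \<in> M"
    using commutator_lower_central[of "inv u" n "inv x"] M subgroup.m_inv_closed[OF M(1) \<open>u \<in> M\<close>] assms by blast
  then have "u \<otimes> (inv u \<otimes> inv x \<otimes> inv (inv u) \<otimes> inv (inv x)) \<in> M"
    using subgroup.m_closed[OF M(1) \<open>u \<in> M\<close>] by blast
  then show ?thesis using uG \<open>x \<in> carrier G\<close> by (simp add: m_assoc)
qed

lemma lower_central_Suc_subset: "lower_central G (Suc n) \<subseteq> lower_central G n"
proof (induction n)
  case 0
  then show ?case using lower_central_carrier[of _ "Suc 0"] by (auto simp del: lower_central.simps(2))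
next
  case (Suc n)
  have "a \<otimes> b \<otimes> inv a \<otimes> inv b \<in> lower_central G (Suc n)"
    if a: "a \<in> lower_central G (Suc n)" and b: "b \<in> carrier G" for a b
    by (rule commutator_lower_central) (use Suc a b in blast)+
  then show ?case
    unfolding lower_central.simps(2)[of G "Suc n"]
    by (intro generate_subgroup_incl subgroup_lower_central) blast
qed

text \<open>Commutators are bilinear modulo the term after the next, so commutators of generators of
  one factor with generators of \<open>G\<close> generate the following factor.\<close>

lemma lower_central_quotient_finitely_generated:
  assumes S: "finite S" "S \<subseteq> carrier G" "generate G S = carrier G"
  shows "\<exists>T. finite T \<and> T \<subseteq> lower_central G n \<and>
    lower_central G n \<subseteq> generate G (T \<union> lower_central G (Suc n))"
proof (induction n)
  case 0
  have "carrier G \<subseteq> generate G (S \<union> lower_central G (Suc 0))"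
    unfolding S(3)[symmetric] by (rule mono_generate) blast
  then show ?case using S(1,2) by (intro exI[of _ S]) (simp del: lower_central.simps(2))
next
  case (Suc n)
  then obtain T where T: "finite T" "T \<subseteq> lower_central G n"
    "lower_central G n \<subseteq> generate G (T \<union> lower_central G (Suc n))" by blast
  let ?c = "\<lambda>a b. a \<otimes> b \<otimes> inv a \<otimes> inv b"
  define C where "C = (\<lambda>(a, b). ?c a b) ` (T \<times> S)"
  \<comment> \<open>The goal becomes \<open>lower_central G (Suc n) \<subseteq> M\<close>. In place
    of bilinearity, the elements whose commutators fall into the normal subgroup \<open>M\<close>
    are shown to form subgroups, first in the second argument and then in the first.\<close>
  define M where "M = generate G (C \<union> lower_central G (Suc (Suc n)))"
  have C_sub: "C \<subseteq> lower_central G (Suc n)"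
    unfolding C_def
    by (auto intro!: commutator_lower_central[OF subsetD[OF T(2)] subsetD[OF S(2)]] simp del: lower_central.simps(2))
  have gen_sub: "C \<union> lower_central G (Suc (Suc n)) \<subseteq> lower_central G (Suc n)"
    using C_sub lower_central_Suc_subset by blast
  have M: "subgroup M G"
    unfolding M_def using gen_sub subgroup.subset[OF subgroup_lower_central] by (intro generate_is_subgroup) blast
  have M_lower: "lower_central G (Suc (Suc n)) \<subseteq> M" "C \<subseteq> M"
    unfolding M_def by (auto intro: generate.incl simp del: lower_central.simps(2))
  have M_upper: "M \<subseteq> lower_central G (Suc n)"
    unfolding M_def by (intro generate_subgroup_incl[OF gen_sub] subgroup_lower_central)
  note conj = conj_between_lower_central[OF M M_lower(1) M_upper]
  have conj': "x \<otimes> u \<otimes> inv x \<in> M" if "u \<in> M" "x \<in> carrier G" for x u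
    using inv_normalizes[OF M subgroup_self conj that(2,1)] .
  have comm_S: "?c s b \<in> M" if s: "s \<in> T" and b: "b \<in> carrier G" for s b
  proof -
    have sG: "s \<in> carrier G" using s T(2) lower_central_carrier by blast
    have "subgroup {b \<in> carrier G. ?c s b \<in> M} G"
    proof (rule subgroupI)
      show "{b \<in> carrier G. ?c s b \<in> M} \<noteq> {}"
        using sG subgroup.one_closed[OF M] by (auto intro!: exI[of _ \<one>])
      show "inv b \<in> {b \<in> carrier G. ?c s b \<in> M}" if b: "b \<in> {b \<in> carrier G. ?c s b \<in> M}" for b
      proof -
        have bG: "b \<in> carrier G" and bM: "?c s b \<in> M" using b by auto
        have "inv b \<otimes> inv (?c s b) \<otimes> b \<in> M" by (rule conj[OF subgroup.m_inv_closed[OF M bM] bG])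
        then show ?thesis using bG sG by (simp add: inv_mult_group m_assoc)
      qed
      show "b \<otimes> b' \<in> {b \<in> carrier G. ?c s b \<in> M}"
        if b: "b \<in> {b \<in> carrier G. ?c s b \<in> M}" "b' \<in> {b \<in> carrier G. ?c s b \<in> M}" for b b'
      proof -
        have bG: "b \<in> carrier G" "b' \<in> carrier G" and bM: "?c s b \<in> M" "?c s b' \<in> M" using b by auto
        \<comment> \<open>This product is the commutator of \<open>s\<close> with
          \<open>b \<otimes> b'\<close>.\<close>
        have "?c s b \<otimes> (b \<otimes> ?c s b' \<otimes> inv b) \<in> M"
          by (rule subgroup.m_closed[OF M bM(1) conj'[OF bM(2) bG(1)]])
        then show ?thesis using bG sG by (simp add: inv_mult_group m_assoc)
      qed
    qed blast
    moreover have "S \<subseteq> {b \<in> carrier G. ?c s b \<in> M}"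
      using S(2) M_lower(2) s by (auto simp: C_def)
    ultimately have "carrier G \<subseteq> {b \<in> carrier G. ?c s b \<in> M}"
      unfolding S(3)[symmetric] by (rule generate_subgroup_incl[rotated])
    then show ?thesis using b by blast
  qed
  \<comment> \<open>\<open>?Z\<close> is the preimage of the centre of \<open>G / M\<close>. It
    contains \<open>T\<close> by \<open>comm_S\<close>, and \<open>lower_central G (Suc n)\<close>
    because commutators with that term drop one step further; hence it contains
    \<open>lower_central G n\<close>.\<close>
  have "subgroup {a \<in> carrier G. \<forall>b\<in>carrier G. ?c a b \<in> M} G" (is "subgroup ?Z G")
  proof (rule subgroupI)
    show "?Z \<noteq> {}" using subgroup.one_closed[OF M] by (auto intro!: exI[of _ \<one>])
    show "inv a \<in> ?Z" if a: "a \<in> ?Z" for a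
    proof -
      have "?c (inv a) b \<in> M" if b: "b \<in> carrier G" for b
      proof -
        have aG: "a \<in> carrier G" and aM: "?c a b \<in> M" using a b by auto
        have "inv a \<otimes> inv (?c a b) \<otimes> a \<in> M" by (rule conj[OF subgroup.m_inv_closed[OF M aM] aG])
        then show ?thesis using aG b by (simp add: inv_mult_group m_assoc)
      qed
      then show ?thesis using a by simp
    qed
    show "a \<otimes> a' \<in> ?Z" if a: "a \<in> ?Z" "a' \<in> ?Z" for a a'
    proof -
      have "?c (a \<otimes> a') b \<in> M" if b: "b \<in> carrier G" for b
      proof -
        have aG: "a \<in> carrier G" "a' \<in> carrier G" and aM: "?c a b \<in> M" "?c a' b \<in> M" using a b by auto
        have "(a \<otimes> ?c a' b \<otimes> inv a) \<otimes> ?c a b \<in> M"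
          by (rule subgroup.m_closed[OF M conj'[OF aM(2) aG(1)] aM(1)])
        then show ?thesis using aG b by (simp add: inv_mult_group m_assoc)
      qed
      then show ?thesis using a by simp
    qed
  qed blast
  moreover have "T \<union> lower_central G (Suc n) \<subseteq> ?Z"
  proof -
    have "a \<in> ?Z" if a: "a \<in> lower_central G (Suc n)" for a
      using commutator_lower_central[OF a] M_lower(1) lower_central_carrier[OF a] by blast
    then show ?thesis using comm_S T(2) lower_central_carrier by blast
  qed
  ultimately have "lower_central G n \<subseteq> ?Z"
    using T(3) generate_subgroup_incl by blast
  then have "lower_central G (Suc n) \<subseteq> M"
    unfolding lower_central.simps(2)[of G n] by (intro generate_subgroup_incl M) blast
  moreover have "finite C" unfolding C_def using T(1) S(1) by simp
  ultimately show ?case using C_sub unfolding M_def by blast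
qed

text \<open>Generators are adjoined one at a time. Each intermediate group lies between consecutive
  terms of the lower central series, so it is normal in the next one, with quotient generated by the
  image of \<open>t\<close>.\<close>

lemma polycyclic_central_extension:
  assumes "finite T" "T \<subseteq> lower_central G n" "polycyclic_subgroup G (lower_central G (Suc n))"
  shows "polycyclic_subgroup G (generate G (T \<union> lower_central G (Suc n)))"
  using assms(1,2)
proof (induction T)
  case empty
  have "generate G (lower_central G (Suc n)) = lower_central G (Suc n)"
    using generate_subgroup_incl[OF subset_refl subgroup_lower_central] generate.incl
    by (metis subsetI subset_antisym)
  then show ?case using assms(3) by (simp del: lower_central.simps(2))
next
  case (insert t T)
  define M where "M = generate G (T \<union> lower_central G (Suc n))"
  define A where "A = generate G (insert t T \<union> lower_central G (Suc n))"
  have sub: "insert t T \<union> lower_central G (Suc n) \<subseteq> lower_central G n"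
    using insert.prems lower_central_Suc_subset by blast
  then have subG: "insert t T \<union> lower_central G (Suc n) \<subseteq> carrier G" using lower_central_carrier by blast
  have A: "subgroup A G" unfolding A_def using subG by (rule generate_is_subgroup)
  have M: "subgroup M G" unfolding M_def using subG by (intro generate_is_subgroup) blast
  have "A \<subseteq> lower_central G n" unfolding A_def by (rule generate_subgroup_incl[OF sub subgroup_lower_central])
  moreover have MA: "M \<subseteq> A" unfolding M_def A_def by (rule mono_generate) blast
  ultimately have M_upper: "M \<subseteq> lower_central G n" by blast
  have M_lower: "T \<union> lower_central G (Suc n) \<subseteq> M" unfolding M_def by (blast intro: generate.incl)
  have tA: "t \<in> A" unfolding A_def by (blast intro: generate.incl)
  have tG: "t \<in> carrier G" using A tA by (rule subgroup.mem_carrier)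
  have conj: "inv x \<otimes> u \<otimes> x \<in> M" if "x \<in> A" "u \<in> M" for x u
    using conj_between_lower_central[OF M _ M_upper that(2) subgroup.mem_carrier[OF A that(1)]] M_lower by blast
  let ?S = "{x \<in> carrier G. \<exists>m::int. inv (t [^] m) \<otimes> x \<in> M}"
  have "x \<in> ?S" if "x \<in> M" for x
    using that subgroup.mem_carrier[OF M that] by (auto intro!: exI[of _ 0])
  moreover have "t \<in> ?S"
    using tG subgroup.one_closed[OF M] by (auto intro!: exI[of _ 1])
  ultimately have "insert t T \<union> lower_central G (Suc n) \<subseteq> ?S" using M_lower by blast
  then have A_sub: "A \<subseteq> ?S"
    unfolding A_def by (rule generate_subgroup_incl[OF _ subgroup_powers_times[OF M A tA conj]])
  have "polycyclic_subgroup G M" unfolding M_def using insert by blast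
  then have "polycyclic_subgroup G A"
    by (rule polycyclic_subgroup.cyclic_extension[OF _ M A MA tA conj]) (use A_sub in blast)+
  then show ?case unfolding A_def .
qed

theorem fg_nilpotent_polycyclic:
  assumes "finitely_generated_group G" "nilpotent_group G"
  shows "polycyclic_subgroup G (carrier G)"
proof -
  obtain S where S: "finite S" "S \<subseteq> carrier G" "generate G S = carrier G"
    using assms(1) unfolding finitely_generated_group_def by blast
  obtain n where n: "lower_central G n = {\<one>}" using assms(2) unfolding nilpotent_group_def by blast
  have "polycyclic_subgroup G (lower_central G 0)"
    \<comment> \<open>Downward induction, from the trivial term up to the whole group.\<close>
    using le0[of n]
  proof (induction rule: inc_induct)
    case base
    then show ?case unfolding n by (rule polycyclic_subgroup.trivial)
  next
    case (step m)
    obtain T where T: "finite T" "T \<subseteq> lower_central G m"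
      "lower_central G m \<subseteq> generate G (T \<union> lower_central G (Suc m))"
      using lower_central_quotient_finitely_generated[OF S] by blast
    have "generate G (T \<union> lower_central G (Suc m)) \<subseteq> lower_central G m"
      using T(2) lower_central_Suc_subset by (intro generate_subgroup_incl subgroup_lower_central) blast
    then show ?case using polycyclic_central_extension[OF T(1,2) step.IH] T(3) by simp
  qed
  then show ?thesis by simp
qed

end

section \<open>The closure of an equicontinuous Cantor action\<close>

locale equicontinuous_cantor_action =
  fixes G :: "('g, 'm) monoid_scheme" (structure) and \<phi> :: "'g \<Rightarrow> 'x::metric_space \<Rightarrow> 'x"
  assumes cantor: "cantor_action G \<phi>" and equicontinuous: "equicontinuous_action G \<phi>"
begin

abbreviation K :: "('x \<Rightarrow> 'x) monoid" where "K \<equiv> closure_group G \<phi>"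

lemma compact_UNIV: "compact (UNIV :: 'x set)"
  using cantor by (simp add: cantor_action_def cantor_space_def)

sublocale homeo: Metric_space "Homeo :: ('x \<Rightarrow> 'x) set" uniform_dist
  by (rule Metric_space_Homeo[OF compact_UNIV])

sublocale group_action G UNIV \<phi>
  using cantor by (simp add: cantor_action_def)

sublocale G: group G
  using group_hom group_hom.axioms(1) by blast

lemma bounded_all: "bounded (S :: 'x set)"
  using compact_imp_bounded[OF compact_UNIV] bounded_subset by blast

lemma dist_le_uniform_dist: "dist (f x) (g x) \<le> uniform_dist f (g :: 'x \<Rightarrow> 'x)"
proof -
  obtain B where "\<And>x y :: 'x. dist x y \<le> B"
    using bounded_all[of UNIV] by (metis UNIV_I bounded_two_points)
  then have "bdd_above (range (\<lambda>x. dist (f x) (g x)))" by (intro bdd_aboveI) auto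
  then show ?thesis unfolding uniform_dist_def by (rule cSUP_upper[OF UNIV_I])
qed

lemma uniform_dist_le: "(\<And>x. dist (f x) (g x) \<le> e) \<Longrightarrow> uniform_dist f (g :: 'x \<Rightarrow> 'x) \<le> e"
  unfolding uniform_dist_def by (intro cSUP_least) auto

lemma Homeo_iff: "f \<in> (Homeo :: ('x \<Rightarrow> 'x) set) \<longleftrightarrow> continuous_on UNIV f \<and> bij f"
proof
  assume "f \<in> Homeo"
  then obtain g where g: "homeomorphism UNIV UNIV f g" unfolding Homeo_def by blast
  then have "bij f" unfolding homeomorphism_def by (intro o_bij[of g]) auto
  then show "continuous_on UNIV f \<and> bij f" using g unfolding homeomorphism_def by simp
next
  assume "continuous_on UNIV f \<and> bij f"
  then show "f \<in> Homeo"
    unfolding Homeo_def using homeomorphism_compact[OF compact_UNIV, of f UNIV] by (simp add: bij_def)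
qed

lemma act_mult: "g \<in> carrier G \<Longrightarrow> h \<in> carrier G \<Longrightarrow> \<phi> (g \<otimes> h) y = \<phi> g (\<phi> h y)"
  by (rule composition_rule) auto

lemma act_one: "\<phi> \<one> y = y"
  using fun_cong[OF id_eq_one, of y] by simp

lemma act_inv: "g \<in> carrier G \<Longrightarrow> \<phi> (inv g) (\<phi> g y) = y" "g \<in> carrier G \<Longrightarrow> \<phi> g (\<phi> (inv g) y) = y"
  using act_mult[of "inv g" g y] act_mult[of g "inv g" y] by (simp_all add: act_one)

lemma act_equicontinuous:
  "e > 0 \<Longrightarrow> \<exists>d>0. \<forall>x y. dist x y < d \<longrightarrow> (\<forall>g\<in>carrier G. dist (\<phi> g x) (\<phi> g y) < e)"
  using equicontinuous unfolding equicontinuous_action_def by blast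

text \<open>Bijectivity does not survive uniform limits in general. Here equicontinuity also covers
  the inverses, which keeps distinct points apart, and the range is dense as well as closed by
  compactness.\<close>

lemma limit_Homeo:
  assumes approx: "\<And>e. e > 0 \<Longrightarrow> \<exists>g\<in>carrier G. \<forall>x. dist (f x) (\<phi> g x) < e"
  shows "f \<in> Homeo"
proof -
  have cont: "continuous_on UNIV f"
    unfolding continuous_on_iff
  proof (intro ballI allI impI)
    fix x :: 'x and e :: real assume "e > 0"
    then obtain d where d: "d > 0" "\<And>x y g. dist x y < d \<Longrightarrow> g \<in> carrier G \<Longrightarrow> dist (\<phi> g x) (\<phi> g y) < e / 3"
      using act_equicontinuous[of "e / 3"] by auto
    obtain g where g: "g \<in> carrier G" "\<And>x. dist (f x) (\<phi> g x) < e / 3"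
      using approx[of "e / 3"] \<open>e > 0\<close> by auto
    have "dist (f y) (f x) < e" if "dist y x < d" for y
      using d(2)[OF that g(1)] g(2)[of y] g(2)[of x]
        dist_triangle[of "f y" "f x" "\<phi> g y"] dist_triangle2[of "\<phi> g y" "f x" "\<phi> g x"] by linarith
    then show "\<exists>d>0. \<forall>y\<in>UNIV. dist y x < d \<longrightarrow> dist (f y) (f x) < e" using d(1) by blast
  qed
  have "inj f"
  proof (rule injI)
    fix x y assume eq: "f x = f y"
    have "dist x y < e" if e: "e > 0" for e
    proof -
      obtain d where d: "d > 0" "\<And>x y g. dist x y < d \<Longrightarrow> g \<in> carrier G \<Longrightarrow> dist (\<phi> g x) (\<phi> g y) < e"
        using act_equicontinuous[OF e] by auto
      obtain g where g: "g \<in> carrier G" "\<And>x. dist (f x) (\<phi> g x) < d / 2"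
        using approx[of "d / 2"] d(1) by auto
      have "dist (\<phi> g x) (\<phi> g y) < d"
        using g(2)[of x] g(2)[of y] dist_triangle3[of "\<phi> g x" "\<phi> g y" "f x"] eq by simp
      then have "dist (\<phi> (inv g) (\<phi> g x)) (\<phi> (inv g) (\<phi> g y)) < e" using d(2) g(1) by simp
      then show ?thesis using g(1) by (simp add: act_inv)
    qed
    then show "x = y" by (metis less_irrefl zero_less_dist_iff)
  qed
  moreover have "surj f"
  proof -
    have "closed (range f)"
      using compact_continuous_image[OF cont compact_UNIV] by (rule compact_imp_closed)
    moreover have "y \<in> closure (range f)" for y
      unfolding closure_approachable
    proof (intro allI impI)
      fix e :: real assume "e > 0"
      then obtain g where g: "g \<in> carrier G" "\<And>x. dist (f x) (\<phi> g x) < e" using approx by blast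
      have "dist (f (\<phi> (inv g) y)) y < e" using g(2)[of "\<phi> (inv g) y"] g(1) by (simp add: act_inv)
      then show "\<exists>z\<in>range f. dist z y < e" by blast
    qed
    ultimately show ?thesis by auto
  qed
  ultimately show ?thesis using cont by (simp add: Homeo_iff bij_def)
qed

text \<open>Trades the closure in the sup metric for pointwise estimates with one \<open>g\<close>
  for all points; \<open>limit_Homeo\<close> supplies membership in \<open>Homeo\<close>.\<close>

lemma carrier_K_iff: "f \<in> carrier K \<longleftrightarrow> (\<forall>e>0. \<exists>g\<in>carrier G. \<forall>x. dist (f x) (\<phi> g x) < e)"
proof -
  have act_Homeo: "\<phi> g \<in> Homeo" if "g \<in> carrier G" for g
    using cantor that unfolding cantor_action_def by blast
  have carrier: "carrier K = {f \<in> Homeo. \<forall>r>0. \<exists>h\<in>\<phi> ` carrier G. h \<in> homeo.mball f r}"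
    by (simp add: closure_group_def Homeo_topology_def homeo.metric_closure_of)
  show ?thesis
  proof
    assume f: "f \<in> carrier K"
    show "\<forall>e>0. \<exists>g\<in>carrier G. \<forall>x. dist (f x) (\<phi> g x) < e"
    proof (intro allI impI)
      fix e :: real assume "e > 0"
      then obtain g where "g \<in> carrier G" "uniform_dist f (\<phi> g) < e" using f unfolding carrier by auto
      then show "\<exists>g\<in>carrier G. \<forall>x. dist (f x) (\<phi> g x) < e"
        using dist_le_uniform_dist le_less_trans by blast
    qed
  next
    assume approx: "\<forall>e>0. \<exists>g\<in>carrier G. \<forall>x. dist (f x) (\<phi> g x) < e"
    have fH: "f \<in> Homeo" by (rule limit_Homeo) (use approx in blast)
    have "\<exists>h\<in>\<phi> ` carrier G. h \<in> homeo.mball f r" if r: "r > 0" for r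
    proof -
      \<comment> \<open>A supremum of distances below \<open>r / 2\<close> may equal
        \<open>r / 2\<close>; halving restores the strict inequality.\<close>
      obtain g where g: "g \<in> carrier G" "\<forall>x. dist (f x) (\<phi> g x) < r / 2"
        using approx[rule_format, of "r / 2"] r by auto
      have "uniform_dist f (\<phi> g) \<le> r / 2" using g(2) by (intro uniform_dist_le) (simp add: less_imp_le)
      then have "\<phi> g \<in> homeo.mball f r" using r g(1) act_Homeo fH by simp
      then show ?thesis using g(1) by blast
    qed
    then show "f \<in> carrier K" unfolding carrier using fH by blast
  qed
qed

lemma K_Homeo: "f \<in> carrier K \<Longrightarrow> f \<in> Homeo"
  by (rule limit_Homeo) (simp add: carrier_K_iff)

lemma K_bij: "f \<in> carrier K \<Longrightarrow> bij f"
  using K_Homeo[of f] by (simp add: Homeo_iff)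

lemma K_Bij: "f \<in> carrier K \<Longrightarrow> f \<in> Bij UNIV"
  using K_bij[of f] by (simp add: Bij_def extensional_def)

lemma act_in_K: "g \<in> carrier G \<Longrightarrow> \<phi> g \<in> carrier K"
  unfolding carrier_K_iff by (intro allI impI bexI[of _ g]) auto

lemma K_limit:
  assumes "\<And>e. e > 0 \<Longrightarrow> \<exists>h\<in>carrier K. \<forall>x. dist (f x) (h x) < e"
  shows "f \<in> carrier K"
  unfolding carrier_K_iff
proof (intro allI impI)
  fix e :: real assume e: "e > 0"
  obtain h where h: "h \<in> carrier K" "\<And>x. dist (f x) (h x) < e / 2" using assms[of "e / 2"] e by auto
  have "e / 2 > 0" using e by simp
  then obtain g where g: "g \<in> carrier G" "\<And>x. dist (h x) (\<phi> g x) < e / 2"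
    using h(1) unfolding carrier_K_iff by blast
  have "dist (f x) (\<phi> g x) < e" for x
    using h(2)[of x] g(2)[of x] dist_triangle[of "f x" "\<phi> g x" "h x"] by linarith
  then show "\<exists>g\<in>carrier G. \<forall>x. dist (f x) (\<phi> g x) < e" using g(1) by blast
qed

lemma K_equicontinuous:
  assumes "e > 0"
  shows "\<exists>d>0. \<forall>x y. dist x y < d \<longrightarrow> (\<forall>f\<in>carrier K. dist (f x) (f y) < e)"
proof -
  have e3: "e / 3 > 0" using assms by simp
  obtain d where d: "d > 0" "\<And>x y g. dist x y < d \<Longrightarrow> g \<in> carrier G \<Longrightarrow> dist (\<phi> g x) (\<phi> g y) < e / 3"
    using act_equicontinuous[OF e3] by auto
  have "dist (f x) (f y) < e" if xy: "dist x y < d" and f: "f \<in> carrier K" for x y f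
  proof -
    obtain g where g: "g \<in> carrier G" "\<And>x. dist (f x) (\<phi> g x) < e / 3"
      using f e3 unfolding carrier_K_iff by blast
    show ?thesis
      using d(2)[OF xy g(1)] g(2)[of y] g(2)[of x]
        dist_triangle[of "f x" "f y" "\<phi> g x"] dist_triangle2[of "\<phi> g x" "f y" "\<phi> g y"] by linarith
  qed
  then show ?thesis using d(1) by blast
qed

lemma comp_in_K:
  assumes f: "f \<in> carrier K" and h: "h \<in> carrier K"
  shows "(\<lambda>x. f (h x)) \<in> carrier K"
proof -
  have approx: "\<exists>g'\<in>carrier G. \<forall>x. dist (f (h x)) (\<phi> g' x) < e" if e: "e > 0" for e
  proof -
    have e2: "e / 2 > 0" using e by simp
    obtain d where d: "d > 0" "\<And>x y g. dist x y < d \<Longrightarrow> g \<in> carrier G \<Longrightarrow> dist (\<phi> g x) (\<phi> g y) < e / 2"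
      using act_equicontinuous[OF e2] by auto
    obtain g where g: "g \<in> carrier G" "\<And>x. dist (f x) (\<phi> g x) < e / 2"
      using f e2 unfolding carrier_K_iff by blast
    obtain g' where g': "g' \<in> carrier G" "\<And>x. dist (h x) (\<phi> g' x) < d"
      using h d(1) unfolding carrier_K_iff by blast
    have "dist (f (h x)) (\<phi> (g \<otimes> g') x) < e" for x
      using g(2)[of "h x"] d(2)[OF g'(2) g(1), of x] g(1) g'(1)
        dist_triangle[of "f (h x)" "\<phi> g (\<phi> g' x)" "\<phi> g (h x)"] by (simp add: act_mult)
    then show ?thesis using g(1) g'(1) by blast
  qed
  then show ?thesis unfolding carrier_K_iff by blast
qed

lemma inv_in_K:
  assumes f: "f \<in> carrier K"
  shows "inv_into UNIV f \<in> carrier K"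
proof -
  have approx: "\<exists>g'\<in>carrier G. \<forall>x. dist (inv_into UNIV f x) (\<phi> g' x) < e" if e: "e > 0" for e
  proof -
    obtain d where d: "d > 0" "\<And>x y g. dist x y < d \<Longrightarrow> g \<in> carrier G \<Longrightarrow> dist (\<phi> g x) (\<phi> g y) < e"
      using act_equicontinuous[OF e] by auto
    obtain g where g: "g \<in> carrier G" "\<And>x. dist (f x) (\<phi> g x) < d"
      using f d(1) unfolding carrier_K_iff by blast
    have "dist (inv_into UNIV f x) (\<phi> (inv g) x) < e" for x
    proof -
      define y where "y = inv_into UNIV f x"
      have x: "x = f y" unfolding y_def using K_bij[OF f] by (simp add: bij_is_surj surj_f_inv_f)
      have "dist (\<phi> (inv g) (f y)) (\<phi> (inv g) (\<phi> g y)) < e" using d(2)[OF g(2)] g(1) by simp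
      then show ?thesis unfolding y_def[symmetric] using g(1) x by (simp add: act_inv dist_commute)
    qed
    then show ?thesis using g(1) by blast
  qed
  then show ?thesis unfolding carrier_K_iff by blast
qed

lemma K_mult:
  assumes "f \<in> carrier K" "h \<in> carrier K"
  shows "f \<otimes>\<^bsub>K\<^esub> h = (\<lambda>x. f (h x))"
proof -
  have "f \<in> Bij UNIV" "h \<in> Bij UNIV" using assms by (simp_all only: K_Bij)
  moreover have "mult K = mult (BijGroup UNIV)" by (simp add: closure_group_def)
  ultimately show ?thesis by (simp add: BijGroup_def compose_def fun_eq_iff)
qed

lemma K_one: "\<one>\<^bsub>K\<^esub> = (\<lambda>x. x)"
  by (simp add: closure_group_def BijGroup_def fun_eq_iff)

lemma id_in_K: "(\<lambda>x. x) \<in> carrier K"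
  using act_in_K[OF G.one_closed] act_one by (metis ext)

sublocale K: group K
proof (rule groupI)
  show "\<exists>h\<in>carrier K. h \<otimes>\<^bsub>K\<^esub> f = \<one>\<^bsub>K\<^esub>" if "f \<in> carrier K" for f
    by (rule bexI[of _ "inv_into UNIV f"])
      (simp_all add: that inv_in_K K_mult K_one inv_f_f[OF bij_is_inj[OF K_bij]])
qed (simp_all add: K_mult K_one comp_in_K id_in_K)

lemma K_inv_apply:
  assumes "f \<in> carrier K"
  shows "(inv\<^bsub>K\<^esub> f) (f y) = y" "f ((inv\<^bsub>K\<^esub> f) y) = y"
proof -
  have inv: "inv\<^bsub>K\<^esub> f \<in> carrier K" using assms by simp
  have "inv\<^bsub>K\<^esub> f \<otimes>\<^bsub>K\<^esub> f = \<one>\<^bsub>K\<^esub>" "f \<otimes>\<^bsub>K\<^esub> inv\<^bsub>K\<^esub> f = \<one>\<^bsub>K\<^esub>" using assms by simp_all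
  then show "(inv\<^bsub>K\<^esub> f) (f y) = y" "f ((inv\<^bsub>K\<^esub> f) y) = y"
    using assms inv by (simp_all add: K_mult K_one fun_eq_iff)
qed

lemma act_hom: "\<phi> \<in> hom G K"
  unfolding hom_def using act_in_K by (auto simp: K_mult act_mult)

text \<open>The Arzela-Ascoli argument: a map is coded by rounded values on a finite net, there are
  finitely many codes, and equal codes force uniform closeness.\<close>

lemma mtotally_bounded_K: "homeo.mtotally_bounded (carrier K)"
  unfolding homeo.mtotally_bounded_def
proof (intro allI impI)
  fix e :: real assume e: "e > 0"
  \<comment> \<open>Maps with equal codes differ by at most \<open>4 * r\<close>, half of it from
    equicontinuity and half from rounding; a fifth of \<open>e\<close> makes the bound
    strict.\<close>
  define r where "r = e / 5"
  have r: "r > 0" using e by (simp add: r_def)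
  obtain d where d: "d > 0" "\<And>x y f. dist x y < d \<Longrightarrow> f \<in> carrier K \<Longrightarrow> dist (f x) (f y) < r"
    using K_equicontinuous[OF r] by auto
  obtain C where C: "finite C" "(UNIV :: 'x set) \<subseteq> (\<Union>c\<in>C. ball c d)"
    using compact_UNIV d(1) unfolding compact_eq_totally_bounded by blast
  obtain C' where C': "finite C'" "(UNIV :: 'x set) \<subseteq> (\<Union>c\<in>C'. ball c r)"
    using compact_UNIV r unfolding compact_eq_totally_bounded by blast
  have "\<exists>c\<in>C'. dist c y < r" for y using C'(2) by (auto simp: subset_iff)
  then obtain p where p: "\<And>y. p y \<in> C'" "\<And>y. dist (p y) y < r" by metis
  define code where "code f = (\<lambda>c\<in>C. p (f c))" for f :: "'x \<Rightarrow> 'x"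
  have "code ` carrier K \<subseteq> C \<rightarrow>\<^sub>E C'" using p by (auto simp: code_def)
  then have "finite (code ` carrier K)" using C(1) C'(1) finite_PiE finite_subset by metis
  \<comment> \<open>One map per realised code, since the centres must lie in
    \<open>carrier K\<close>.\<close>
  then obtain Q where Q: "Q \<subseteq> carrier K" "finite Q" "code ` carrier K = code ` Q"
    by (metis finite_subset_image subset_refl)
  have "f \<in> (\<Union>h\<in>Q. homeo.mball h e)" if f: "f \<in> carrier K" for f
  proof -
    obtain h where h: "h \<in> Q" "code h = code f" using Q(3) f by (metis imageE imageI)
    have hK: "h \<in> carrier K" using h Q by blast
    have "dist (h x) (f x) \<le> 4 * r" for x
    proof -
      obtain c where c: "c \<in> C" "dist c x < d" using C(2) by (auto simp: subset_iff)
      have "p (h c) = p (f c)" using fun_cong[OF h(2), of c] c(1) by (simp add: code_def)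
      then have "dist (h c) (f c) < 2 * r"
        using p(2)[of "h c"] p(2)[of "f c"] dist_triangle3[of "h c" "f c" "p (h c)"] by simp
      then show ?thesis
        using d(2)[OF c(2) f] d(2)[OF c(2) hK] dist_triangle3[of "h x" "f x" "h c"]
          dist_triangle[of "h c" "f x" "f c"] by linarith
    qed
    then have "uniform_dist h f \<le> 4 * r" by (rule uniform_dist_le)
    then have "uniform_dist h f < e" using e by (simp add: r_def)
    then show ?thesis using h(1) K_Homeo[OF hK] K_Homeo[OF f] by auto
  qed
  then show "\<exists>Q. finite Q \<and> Q \<subseteq> carrier K \<and> carrier K \<subseteq> (\<Union>h\<in>Q. homeo.mball h e)"
    using Q(1,2) by blast
qed

text \<open>Total boundedness yields a Cauchy subsequence. It converges pointwise by completeness,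
  then uniformly, and \<open>K_limit\<close> keeps the limit in \<open>K\<close>.\<close>

lemma K_cluster_point:
  assumes g: "range g \<subseteq> carrier K"
  shows "\<exists>h\<in>carrier K. \<forall>d>0. \<forall>k::nat. \<exists>n\<ge>k. \<forall>y. dist (h y) (g n y) < d"
proof -
  obtain r :: "nat \<Rightarrow> nat" where r: "strict_mono r" "homeo.MCauchy (g \<circ> r)"
    using mtotally_bounded_K g unfolding homeo.mtotally_bounded_sequentially by blast
  have Cauchy_unif: "\<exists>M. \<forall>m\<ge>M. \<forall>n\<ge>M. \<forall>y. dist (g (r m) y) (g (r n) y) < e" if e: "e > 0" for e
  proof -
    have "\<exists>M. \<forall>m n. M \<le> m \<longrightarrow> M \<le> n \<longrightarrow> uniform_dist (g (r m)) (g (r n)) < e"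
      using r(2) e unfolding homeo.MCauchy_def o_def by blast
    then obtain M where M: "\<And>m n. M \<le> m \<Longrightarrow> M \<le> n \<Longrightarrow> uniform_dist (g (r m)) (g (r n)) < e" by blast
    have "dist (g (r m) y) (g (r n) y) < e" if "M \<le> m" "M \<le> n" for m n y
      using le_less_trans[OF dist_le_uniform_dist M[OF that]] .
    then show ?thesis by blast
  qed
  have "\<exists>l. (\<lambda>n. g (r n) y) \<longlonglongrightarrow> l" for y
  proof -
    have "Cauchy (\<lambda>n. g (r n) y)" unfolding Cauchy_def using Cauchy_unif by blast
    then show ?thesis using compact_imp_complete[OF compact_UNIV] unfolding complete_def by auto
  qed
  then obtain h where h: "\<And>y. (\<lambda>n. g (r n) y) \<longlonglongrightarrow> h y" by metis
  have unif: "\<exists>M. \<forall>n\<ge>M. \<forall>y. dist (h y) (g (r n) y) < e" if e: "e > 0" for e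
  proof -
    obtain M where M: "\<And>m n y. m \<ge> M \<Longrightarrow> n \<ge> M \<Longrightarrow> dist (g (r m) y) (g (r n) y) < e / 2"
      using Cauchy_unif[of "e / 2"] e by auto
    have "dist (h y) (g (r n) y) < e" if n: "n \<ge> M" for n y
    proof -
      have "(\<lambda>m. dist (g (r m) y) (g (r n) y)) \<longlonglongrightarrow> dist (h y) (g (r n) y)"
        by (intro tendsto_dist h tendsto_const)
      then have "dist (h y) (g (r n) y) \<le> e / 2"
        by (rule LIMSEQ_le_const2) (use M[OF _ n] less_imp_le in blast)
      then show ?thesis using e by simp
    qed
    then show ?thesis by blast
  qed
  have "h \<in> carrier K"
  proof (rule K_limit)
    fix e :: real assume "e > 0"
    then show "\<exists>h'\<in>carrier K. \<forall>y. dist (h y) (h' y) < e" using unif g by (meson order_refl rangeI subsetD)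
  qed
  moreover have "\<exists>n\<ge>k. \<forall>y. dist (h y) (g n y) < d" if d: "d > 0" for d and k :: nat
  proof -
    obtain M where M: "\<And>n y. n \<ge> M \<Longrightarrow> dist (h y) (g (r n) y) < d" using unif[OF d] by blast
    have "r (max M k) \<ge> k" using seq_suble[OF r(1), of "max M k"] by simp
    then show ?thesis using M[of "max M k"] by auto
  qed
  ultimately show ?thesis by blast
qed

text \<open>Minimality enters here: elements of the acting group move \<open>x\<close> ever closer
  to \<open>y\<close>, and a cluster point of them in \<open>K\<close> moves \<open>x\<close>
  exactly to \<open>y\<close>.\<close>

lemma K_transitive: "\<exists>h\<in>carrier K. h x = y"
proof -
  have "closure (orbit G \<phi> x) = UNIV" using cantor unfolding cantor_action_def by simp
  then have "\<exists>z\<in>orbit G \<phi> x. dist z y < inverse (Suc n)" for n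
    using closure_approachable[of y "orbit G \<phi> x"] by simp
  then have "\<exists>g\<in>carrier G. dist (\<phi> g x) y < inverse (Suc n)" for n
    unfolding orbit_def by blast
  then obtain g where g: "\<And>n. g n \<in> carrier G" "\<And>n. dist (\<phi> (g n) x) y < inverse (Suc n)" by metis
  have "range (\<lambda>n. \<phi> (g n)) \<subseteq> carrier K" using g(1) act_in_K by auto
  then obtain h where h: "h \<in> carrier K" "\<And>d k. d > 0 \<Longrightarrow> \<exists>n\<ge>k::nat. \<forall>z. dist (h z) (\<phi> (g n) z) < d"
    using K_cluster_point[of "\<lambda>n. \<phi> (g n)"] by blast
  have "dist (h x) y < e" if e: "e > 0" for e
  proof -
    obtain k where k: "inverse (Suc k) < e / 2" using reals_Archimedean[of "e / 2"] e by auto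
    obtain n where n: "n \<ge> k" "\<And>z. dist (h z) (\<phi> (g n) z) < e / 2" using h(2)[of "e / 2" k] e by auto
    have "inverse (real (Suc n)) \<le> inverse (Suc k)" using n(1) by (simp add: field_simps)
    then show ?thesis
      using k n(2)[of x] g(2)[of n] dist_triangle[of "h x" y "\<phi> (g n) x"] by linarith
  qed
  then have "h x = y" by (metis less_irrefl zero_less_dist_iff)
  then show ?thesis using h(1) by blast
qed

end

section \<open>Exponents and primes read off from finite quotients\<close>

lemma (in group) power_order_FactGroup:
  assumes "M \<lhd> G" "h \<in> carrier G"
  shows "h [^] order (G Mod M) \<in> M"
proof -
  interpret M: normal M G by fact
  interpret Q: group "G Mod M" by (rule M.factorgroup_is_group)
  interpret proj: group_hom G "G Mod M" "\<lambda>a. M #> a"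
    by unfold_locales (rule M.r_coset_hom_Mod)
  have "M #> h \<in> carrier (G Mod M)" using assms(2) by (rule proj.hom_closed)
  then have "(M #> h) [^]\<^bsub>G Mod M\<^esub> order (G Mod M) = \<one>\<^bsub>G Mod M\<^esub>" by (rule Q.pow_order_eq_1)
  then have "M #> (h [^] order (G Mod M)) = M" using assms(2) by (simp add: proj.hom_nat_pow FactGroup_def)
  then show ?thesis using assms(2) rcos_self[OF _ M.subgroup_axioms, of "h [^] order (G Mod M)"] by simp
qed

text \<open>Positivity of \<open>q\<close> matters: \<open>multiplicity p 0 = 0\<close> although
  \<open>p dvd 0\<close>, so an infinite quotient, of order 0, would contribute nothing. Hence the
  finiteness of coset spaces is carried along below.\<close>

lemma prime_in_spectrum:
  assumes "steinitz_of_nat q \<in> A" "prime p" "p dvd q" "q > 0"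
  shows "p \<in> prime_spectrum (steinitz_LCM A)"
proof -
  have "0 < steinitz_of_nat q p"
    using assms(2-4) by (simp add: steinitz_of_nat_def zero_enat_def prime_multiplicity_gt_zero_iff)
  also have "\<dots> \<le> steinitz_LCM A p" unfolding steinitz_LCM_def by (rule SUP_upper[OF assms(1)])
  finally show ?thesis using assms(2) by (simp add: prime_spectrum_def)
qed

section \<open>Clopen sets and small open normal subgroups\<close>

context equicontinuous_cantor_action
begin

text \<open>In a compact Hausdorff space components and quasi-components agree, and here they are
  points; a clopen set separates a quasi-component from the compact complement of the ball.\<close>

lemma small_clopen_neighbourhood:
  fixes x :: 'x
  assumes "e > 0"
  shows "\<exists>P. open P \<and> closed P \<and> x \<in> P \<and> P \<subseteq> ball x e"
proof -
  have comp: "compact_space (euclidean :: 'x topology)" using compact_UNIV by (simp add: compact_space_def)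
  have "y = x" if y: "connected_component_of euclidean x y" for y
  proof -
    obtain T where T: "connected T" "x \<in> T" "y \<in> T"
      using y unfolding connected_component_of_def connectedin_iff_connected by blast
    have "\<forall>S :: 'x set. connected S \<longrightarrow> (\<exists>a. S \<subseteq> {a})"
      using cantor by (simp add: cantor_action_def cantor_space_def)
    then show ?thesis using T by blast
  qed
  then have "connected_component_of_set euclidean x = {x}"
    by (auto simp: connected_component_of_refl)
  moreover have "quasi_component_of euclidean x = connected_component_of euclidean x"
    using comp by (intro quasi_eq_connected_component_of) auto
  ultimately have "{x} \<in> quasi_components_of euclidean"
    unfolding quasi_components_of_def by (intro image_eqI[of _ _ x]) simp_all
  moreover have "compact (- ball x e)"
    using closed_Compl[OF open_ball] compact_UNIV compact_Int_closed[of UNIV "- ball x e"] by auto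
  ultimately have "separated_between euclidean {x} (- ball x e)"
    using assms by (simp add: separated_between_quasi_component_compact disjnt_def)
  then show ?thesis unfolding separated_between by auto
qed

lemma finite_clopen_cover:
  assumes "e > 0"
  shows "\<exists>F :: 'x set set. finite F \<and> (\<forall>P\<in>F. open P \<and> closed P) \<and> \<Union>F = UNIV \<and>
    (\<forall>P\<in>F. \<forall>y\<in>P. \<forall>z\<in>P. dist y z < e)"
proof -
  have "\<forall>x :: 'x. \<exists>P. open P \<and> closed P \<and> x \<in> P \<and> P \<subseteq> ball x (e / 2)"
    using small_clopen_neighbourhood[of "e / 2"] assms by simp
  then obtain P where P: "\<And>x :: 'x. open (P x)" "\<And>x. closed (P x)" "\<And>x. x \<in> P x" "\<And>x. P x \<subseteq> ball x (e / 2)"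
    by metis
  have "(UNIV :: 'x set) \<subseteq> (\<Union>x\<in>UNIV. P x)" using P(3) by blast
  then obtain C where C: "finite C" "(UNIV :: 'x set) \<subseteq> (\<Union>x\<in>C. P x)"
    using compactE_image[OF compact_UNIV, of UNIV P] P(1) by metis
  have "dist y z < e" if "y \<in> P x" "z \<in> P x" for x y z
    using subsetD[OF P(4) that(1)] subsetD[OF P(4) that(2)] dist_triangle3[of y z x] by simp
  then show ?thesis using C P by (intro exI[of _ "P ` C"]) auto
qed

text \<open>The witness is a Lebesgue number of the cover by \<open>P\<close> and its
  complement.\<close>

lemma clopen_uniform:
  fixes P :: "'x set"
  assumes "open P" "closed P"
  shows "\<exists>d>0. \<forall>y z. dist y z < d \<longrightarrow> (y \<in> P \<longleftrightarrow> z \<in> P)"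
proof -
  obtain d where d: "d > 0" "\<And>x :: 'x. \<exists>Q\<in>{P, - P}. ball x d \<subseteq> Q"
    using Heine_Borel_lemma[OF compact_UNIV, of "{P, - P}"] assms by (auto simp: open_closed)
  have "y \<in> P \<longleftrightarrow> z \<in> P" if "dist y z < d" for y z
  proof -
    have "y \<in> ball y d" "z \<in> ball y d" using d(1) that by auto
    then show ?thesis using d(2)[of y] by blast
  qed
  then show ?thesis using d(1) by blast
qed

text \<open>
  Taking all translates of the sets in \<open>F\<close> makes this subgroup normal; equicontinuity still keeps it open.
\<close>

definition fixing :: "'x set set \<Rightarrow> ('x \<Rightarrow> 'x) set" where
  "fixing F = {g \<in> carrier K. \<forall>k\<in>carrier K. \<forall>P\<in>F. \<forall>y. k y \<in> P \<longleftrightarrow> k (g y) \<in> P}"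

lemma fixing_in_K: "g \<in> fixing F \<Longrightarrow> g \<in> carrier K"
  unfolding fixing_def by blast

lemma fixingD: "g \<in> fixing F \<Longrightarrow> k \<in> carrier K \<Longrightarrow> P \<in> F \<Longrightarrow> k y \<in> P \<longleftrightarrow> k (g y) \<in> P"
  unfolding fixing_def by blast

lemma normal_fixing: "fixing F \<lhd> K"
proof (rule K.normal_invI)
  show "subgroup (fixing F) K"
  proof (rule K.subgroupI)
    show "fixing F \<subseteq> carrier K" using fixing_in_K by blast
    have "\<one>\<^bsub>K\<^esub> \<in> fixing F" using K.one_closed by (simp add: fixing_def K_one)
    then show "fixing F \<noteq> {}" by blast
    show "inv\<^bsub>K\<^esub> g \<in> fixing F" if g: "g \<in> fixing F" for g
    proof -
      have gK: "g \<in> carrier K" using g by (rule fixing_in_K)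
      have "k y \<in> P \<longleftrightarrow> k ((inv\<^bsub>K\<^esub> g) y) \<in> P" if kP: "k \<in> carrier K" "P \<in> F" for k P y
      proof -
        have "k ((inv\<^bsub>K\<^esub> g) y) \<in> P \<longleftrightarrow> k (g ((inv\<^bsub>K\<^esub> g) y)) \<in> P"
          by (rule fixingD[OF g kP])
        then show ?thesis by (simp add: K_inv_apply(2)[OF gK])
      qed
      then show ?thesis unfolding fixing_def using K.inv_closed[OF gK] by blast
    qed
    show "g \<otimes>\<^bsub>K\<^esub> h \<in> fixing F" if g: "g \<in> fixing F" and h: "h \<in> fixing F" for g h
    proof -
      have gK: "g \<in> carrier K" and hK: "h \<in> carrier K" using g h fixing_in_K by blast+
      have "k y \<in> P \<longleftrightarrow> k (g (h y)) \<in> P" if kP: "k \<in> carrier K" "P \<in> F" for k P y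
      proof -
        have "k y \<in> P \<longleftrightarrow> k (h y) \<in> P" by (rule fixingD[OF h kP])
        also have "\<dots> \<longleftrightarrow> k (g (h y)) \<in> P" by (rule fixingD[OF g kP])
        finally show ?thesis .
      qed
      then show ?thesis unfolding fixing_def K_mult[OF gK hK] using comp_in_K[OF gK hK] by blast
    qed
  qed
  show "h \<otimes>\<^bsub>K\<^esub> g \<otimes>\<^bsub>K\<^esub> inv\<^bsub>K\<^esub> h \<in> fixing F" if h: "h \<in> carrier K" and g: "g \<in> fixing F" for h g
  proof -
    have gK: "g \<in> carrier K" using g by (rule fixing_in_K)
    have "k y \<in> P \<longleftrightarrow> k ((h \<otimes>\<^bsub>K\<^esub> g \<otimes>\<^bsub>K\<^esub> inv\<^bsub>K\<^esub> h) y) \<in> P" if "k \<in> carrier K" "P \<in> F" for k P y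
    proof -
      define z where "z = (inv\<^bsub>K\<^esub> h) y"
      \<comment> \<open>Conjugation by \<open>h\<close> replaces the test map \<open>k\<close> by
        its composite with \<open>h\<close>, again in \<open>K\<close>.\<close>
      have "k (h z) \<in> P \<longleftrightarrow> k (h (g z)) \<in> P"
        by (rule fixingD[OF g comp_in_K[OF that(1) h] that(2)])
      moreover have "h z = y" unfolding z_def by (rule K_inv_apply(2)[OF h])
      moreover have "(h \<otimes>\<^bsub>K\<^esub> g \<otimes>\<^bsub>K\<^esub> inv\<^bsub>K\<^esub> h) y = h (g z)"
        using h gK comp_in_K[OF h gK] by (simp add: K_mult z_def)
      ultimately show ?thesis by simp
    qed
    moreover have "h \<otimes>\<^bsub>K\<^esub> g \<otimes>\<^bsub>K\<^esub> inv\<^bsub>K\<^esub> h \<in> carrier K" using h gK by simp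
    ultimately show ?thesis unfolding fixing_def by blast
  qed
qed

text \<open>Applying \<open>k\<close> after the inverse of \<open>f\<close> to the nearby points
  \<open>f y\<close> and \<open>h y\<close> keeps them close, hence on the same side of each clopen
  set. The uniform \<open>d\<close> yields both openness of the subgroup and cluster points modulo
  it.\<close>

lemma fixing_uniform:
  assumes "finite F" "\<And>P. P \<in> F \<Longrightarrow> open P \<and> closed P"
  shows "\<exists>d>0. \<forall>f\<in>carrier K. \<forall>h\<in>carrier K. (\<forall>y. dist (f y) (h y) < d) \<longrightarrow> inv\<^bsub>K\<^esub> f \<otimes>\<^bsub>K\<^esub> h \<in> fixing F"
proof -
  have "\<exists>d>0. \<forall>P\<in>F. \<forall>y z. dist y z < d \<longrightarrow> (y \<in> P \<longleftrightarrow> z \<in> P)"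
    using assms
  proof (induction F)
    case empty
    then show ?case by (intro exI[of _ 1]) simp
  next
    case (insert P F)
    obtain d where "d > 0" "\<forall>P\<in>F. \<forall>y z. dist y z < d \<longrightarrow> (y \<in> P \<longleftrightarrow> z \<in> P)"
      using insert.IH insert.prems by blast
    moreover obtain d' where "d' > 0" "\<forall>y z. dist y z < d' \<longrightarrow> (y \<in> P \<longleftrightarrow> z \<in> P)"
      using clopen_uniform[of P] insert.prems[OF insertI1] by blast
    ultimately show ?case by (intro exI[of _ "min d d'"] conjI ballI allI impI) (simp, fastforce)
  qed
  then obtain e where e: "e > 0" "\<And>P y z. P \<in> F \<Longrightarrow> dist y z < e \<Longrightarrow> y \<in> P \<longleftrightarrow> z \<in> P" by blast
  obtain d where d: "d > 0" "\<And>y z f. dist y z < d \<Longrightarrow> f \<in> carrier K \<Longrightarrow> dist (f y) (f z) < e"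
    using K_equicontinuous[OF e(1)] by blast
  have "inv\<^bsub>K\<^esub> f \<otimes>\<^bsub>K\<^esub> h \<in> fixing F"
    if f: "f \<in> carrier K" and h: "h \<in> carrier K" and near: "\<And>y. dist (f y) (h y) < d" for f h
  proof -
    have "k y \<in> P \<longleftrightarrow> k ((inv\<^bsub>K\<^esub> f) (h y)) \<in> P" if k: "k \<in> carrier K" and P: "P \<in> F" for k P y
    proof -
      have "dist (k ((inv\<^bsub>K\<^esub> f) (f y))) (k ((inv\<^bsub>K\<^esub> f) (h y))) < e"
        by (rule d(2)[OF near comp_in_K[OF k K.inv_closed[OF f]]])
      then have "k ((inv\<^bsub>K\<^esub> f) (f y)) \<in> P \<longleftrightarrow> k ((inv\<^bsub>K\<^esub> f) (h y)) \<in> P" by (rule e(2)[OF P])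
      then show ?thesis by (simp only: K_inv_apply(1)[OF f])
    qed
    then show ?thesis
      unfolding fixing_def K_mult[OF K.inv_closed[OF f] h] using comp_in_K[OF K.inv_closed[OF f] h] by blast
  qed
  then show ?thesis using d(1) by blast
qed

lemma fixing_open_normal:
  assumes "finite F" "\<And>P. P \<in> F \<Longrightarrow> open P \<and> closed P"
  shows "fixing F \<in> open_normal_subgroups G \<phi>"
proof -
  obtain d where d: "d > 0" "\<And>f h. f \<in> carrier K \<Longrightarrow> h \<in> carrier K \<Longrightarrow>
      (\<And>y. dist (f y) (h y) < d) \<Longrightarrow> inv\<^bsub>K\<^esub> f \<otimes>\<^bsub>K\<^esub> h \<in> fixing F"
    using fixing_uniform[OF assms] by blast
  have sub: "subgroup (fixing F) K" using normal_fixing normal_imp_subgroup by blast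
  define T where "T = (\<Union>f\<in>fixing F. homeo.mball f d)"
  have "openin Homeo_topology T"
    unfolding T_def Homeo_topology_def by (intro openin_Union) auto
  moreover have "fixing F = T \<inter> carrier K"
  proof
    show "fixing F \<subseteq> T \<inter> carrier K"
    proof
      fix f assume f: "f \<in> fixing F"
      have "f \<in> homeo.mball f d" using K_Homeo[OF fixing_in_K[OF f]] d(1) by simp
      then show "f \<in> T \<inter> carrier K" using f fixing_in_K[OF f] unfolding T_def by blast
    qed
    show "T \<inter> carrier K \<subseteq> fixing F"
    proof
      fix h assume h: "h \<in> T \<inter> carrier K"
      then obtain f where f: "f \<in> fixing F" "uniform_dist f h < d" unfolding T_def by auto
      have fK: "f \<in> carrier K" and hK: "h \<in> carrier K" using fixing_in_K[OF f(1)] h by blast+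
      have "inv\<^bsub>K\<^esub> f \<otimes>\<^bsub>K\<^esub> h \<in> fixing F"
        by (rule d(2)[OF fK hK le_less_trans[OF dist_le_uniform_dist f(2)]])
      then have "f \<otimes>\<^bsub>K\<^esub> (inv\<^bsub>K\<^esub> f \<otimes>\<^bsub>K\<^esub> h) \<in> fixing F" by (rule subgroup.m_closed[OF sub f(1)])
      then show "h \<in> fixing F" using fK hK by simp
    qed
  qed
  ultimately have "openin (closure_topology G \<phi>) (fixing F)"
    unfolding closure_topology_def openin_subtopology by blast
  then show ?thesis using normal_fixing by (simp add: open_normal_subgroups_def)
qed

text \<open>Elements of \<open>N k\<close> keep each point in its small clopen piece, so they move
  no point far; conversely, uniformly close elements agree modulo \<open>N k\<close>. Thus the
  \<open>N k\<close> form a neighbourhood basis of the identity in the uniform topology.\<close>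

lemma small_open_normal_subgroups:
  "\<exists>N. compact_filtration K N \<and> (\<forall>k. N k \<in> open_normal_subgroups G \<phi>) \<and>
    (\<forall>k. \<forall>g\<in>N k. \<forall>y. dist (g y) y < inverse (Suc k)) \<and>
    (\<forall>k. \<exists>d>0. \<forall>f\<in>carrier K. \<forall>h\<in>carrier K. (\<forall>y. dist (f y) (h y) < d) \<longrightarrow> inv\<^bsub>K\<^esub> f \<otimes>\<^bsub>K\<^esub> h \<in> N k)"
proof -
  have "\<forall>k. \<exists>F :: 'x set set. finite F \<and> (\<forall>P\<in>F. open P \<and> closed P) \<and> \<Union>F = UNIV \<and>
    (\<forall>P\<in>F. \<forall>y\<in>P. \<forall>z\<in>P. dist y z < inverse (Suc k))"
    by (intro allI finite_clopen_cover) simp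
  then obtain F :: "nat \<Rightarrow> 'x set set" where F: "\<And>k. finite (F k)" "\<And>k P. P \<in> F k \<Longrightarrow> open P \<and> closed P"
    "\<And>k. \<Union>(F k) = UNIV" "\<And>k P y z. P \<in> F k \<Longrightarrow> y \<in> P \<Longrightarrow> z \<in> P \<Longrightarrow> dist y z < inverse (Suc k)"
    by metis
  \<comment> \<open>All covers up to index \<open>k\<close> are used, so that the sequence
    decreases.\<close>
  define N where "N k = fixing (\<Union>j\<le>k. F j)" for k
  have fin: "finite (\<Union>j\<le>k. F j)" for k using F(1) by simp
  have clopen: "open P \<and> closed P" if "P \<in> (\<Union>j\<le>k. F j)" for k P using F(2) that by blast
  have unif: "\<exists>d>0. \<forall>f\<in>carrier K. \<forall>h\<in>carrier K. (\<forall>y. dist (f y) (h y) < d) \<longrightarrow> inv\<^bsub>K\<^esub> f \<otimes>\<^bsub>K\<^esub> h \<in> N k" for k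
    unfolding N_def by (rule fixing_uniform[OF fin clopen])
  have "compact_filtration K N"
  proof (intro compact_filtration.intro compact_filtration_axioms.intro)
    show "group K" by (rule K.is_group)
    show "N k \<lhd> K" for k unfolding N_def by (rule normal_fixing)
    show "N k' \<subseteq> N k" if "k \<le> k'" for k k'
    proof -
      have "(\<Union>j\<le>k. F j) \<subseteq> (\<Union>j\<le>k'. F j)" using that by fastforce
      then show ?thesis unfolding N_def fixing_def by blast
    qed
    show "\<exists>h\<in>carrier K. \<forall>k. \<exists>n\<ge>k. inv\<^bsub>K\<^esub> h \<otimes>\<^bsub>K\<^esub> g n \<in> N k"
      if g: "range g \<subseteq> carrier K" for g :: "nat \<Rightarrow> 'x \<Rightarrow> 'x"
    proof -
      obtain h where h: "h \<in> carrier K" "\<And>d k. d > 0 \<Longrightarrow> \<exists>n\<ge>k::nat. \<forall>y. dist (h y) (g n y) < d"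
        using K_cluster_point[OF g] by blast
      have "\<exists>n\<ge>k. inv\<^bsub>K\<^esub> h \<otimes>\<^bsub>K\<^esub> g n \<in> N k" for k
      proof -
        obtain d where d: "d > 0" "\<And>h'. h' \<in> carrier K \<Longrightarrow> \<forall>y. dist (h y) (h' y) < d \<Longrightarrow> inv\<^bsub>K\<^esub> h \<otimes>\<^bsub>K\<^esub> h' \<in> N k"
          using unif[of k] h(1) by blast
        then show ?thesis using h(2)[OF d(1), of k] g by blast
      qed
      then show ?thesis using h(1) by blast
    qed
  qed
  moreover have "N k \<in> open_normal_subgroups G \<phi>" for k
    unfolding N_def by (rule fixing_open_normal[OF fin clopen])
  moreover have "dist (g y) y < inverse (Suc k)" if g: "g \<in> N k" for k g y
  proof -
    have "y \<in> \<Union>(F k)" by (simp only: F(3) UNIV_I)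
    then obtain P where P: "P \<in> F k" "y \<in> P" by (rule UnionE)
    have "P \<in> (\<Union>j\<le>k. F j)" using P(1) by blast
    then have "g y \<in> P" using iffD1[OF fixingD[OF g[unfolded N_def] id_in_K]] P(2) by blast
    then show ?thesis by (rule F(4)[OF P(1) _ P(2)])
  qed
  ultimately show ?thesis using unif by blast
qed


section \<open>Germ stabilisers at the basepoint and stability\<close>

definition germ_stabiliser :: "'x \<Rightarrow> nat \<Rightarrow> ('x \<Rightarrow> 'x) set" where
  "germ_stabiliser x l = {g \<in> carrier K. \<forall>y. dist y x < inverse (Suc l) \<longrightarrow> g y = y}"

lemma germ_stabiliser_in_K: "g \<in> germ_stabiliser x l \<Longrightarrow> g \<in> carrier K"
  by (simp add: germ_stabiliser_def)

lemma subgroup_germ_stabiliser: "subgroup (germ_stabiliser x l) K"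
proof (rule K.subgroupI)
  show "germ_stabiliser x l \<subseteq> carrier K" using germ_stabiliser_in_K by blast
  have "\<one>\<^bsub>K\<^esub> \<in> germ_stabiliser x l" using K.one_closed by (simp add: germ_stabiliser_def K_one)
  then show "germ_stabiliser x l \<noteq> {}" by blast
  show "inv\<^bsub>K\<^esub> g \<in> germ_stabiliser x l" if g: "g \<in> germ_stabiliser x l" for g
  proof -
    have gK: "g \<in> carrier K" using g by (rule germ_stabiliser_in_K)
    have "(inv\<^bsub>K\<^esub> g) y = y" if "dist y x < inverse (Suc l)" for y
    proof -
      have "g y = y" using g that unfolding germ_stabiliser_def by blast
      then show ?thesis using K_inv_apply(1)[OF gK, of y] by simp
    qed
    then show ?thesis using K.inv_closed[OF gK] unfolding germ_stabiliser_def by blast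
  qed
  show "g \<otimes>\<^bsub>K\<^esub> h \<in> germ_stabiliser x l" if g: "g \<in> germ_stabiliser x l" and h: "h \<in> germ_stabiliser x l" for g h
  proof -
    have gK: "g \<in> carrier K" and hK: "h \<in> carrier K" using g h germ_stabiliser_in_K by blast+
    have "g (h y) = y" if "dist y x < inverse (Suc l)" for y
      using g h that unfolding germ_stabiliser_def by simp
    then show ?thesis using comp_in_K[OF gK hK] unfolding germ_stabiliser_def K_mult[OF gK hK] by blast
  qed
qed

lemma mono_germ_stabiliser: "mono (germ_stabiliser x)"
proof (rule monoI, rule subsetI)
  fix l l' :: nat and g
  assume l: "l \<le> l'" and g: "g \<in> germ_stabiliser x l"
  have "inverse (real (Suc l')) \<le> inverse (Suc l)" using l by (simp add: field_simps)
  then have "g y = y" if "dist y x < inverse (Suc l')" for y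
    using g that less_le_trans unfolding germ_stabiliser_def by blast
  then show "g \<in> germ_stabiliser x l'" using g unfolding germ_stabiliser_def by blast
qed

lemma germ_stabiliser_discriminant: "germ_stabiliser x l \<subseteq> discriminant G \<phi> x"
  unfolding germ_stabiliser_def discriminant_def stabilizer_def closure_action_def by auto

text \<open>
  By transitivity and equicontinuity, the stable radius at the basepoint is a stable radius at every point.
\<close>

lemma stable_if_germ_stabilisers_stabilise:
  assumes L: "\<And>l. l \<ge> L \<Longrightarrow> germ_stabiliser x l \<subseteq> germ_stabiliser x L"
  shows "stable_action G \<phi>"
proof -
  have pos: "inverse (real (Suc L)) > 0" by simp
  \<comment> \<open>This \<open>d\<close> is the radius of quasi-analyticity: moving a point of a
    set \<open>U\<close> of diameter below \<open>d\<close> to \<open>x\<close> by an element of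
    \<open>K\<close> places \<open>U\<close> inside the ball of radius \<open>1/(L+1)\<close> around
    \<open>x\<close>.\<close>
  obtain d where d: "d > 0" "\<And>y z f. dist y z < d \<Longrightarrow> f \<in> carrier K \<Longrightarrow> dist (f y) (f z) < inverse (Suc L)"
    using K_equicontinuous[OF pos] by blast
  have "g u = u"
    if U: "diameter U < d" and V: "open V" "V \<noteq> {}" "V \<subseteq> U" and g: "g \<in> carrier K"
      and fix_V: "\<And>y. y \<in> V \<Longrightarrow> g y = y" and u: "u \<in> U" for U V g u
  proof -
    obtain y where y: "y \<in> V" using V by blast
    obtain h where h: "h \<in> carrier K" "h x = y" using K_transitive by blast
    define h' where "h' = inv\<^bsub>K\<^esub> h"
    have h': "h' \<in> carrier K" "h' y = x" "\<And>z. h (h' z) = z" "\<And>z. h' (h z) = z"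
      unfolding h'_def using K.inv_closed[OF h(1)] K_inv_apply[OF h(1)] h(2)[symmetric] by simp_all
    have "open (h -` V)"
      using K_Homeo[OF h(1)] V(1) unfolding Homeo_iff by (auto intro: open_vimage)
    moreover have "x \<in> h -` V" using h(2) y by simp
    ultimately obtain e where e: "e > 0" "ball x e \<subseteq> h -` V" by (meson openE)
    obtain n where n: "inverse (real (Suc n)) < e" using reals_Archimedean[OF e(1)] by blast
    define l where "l = max n L"
    have "inverse (real (Suc l)) \<le> inverse (Suc n)" by (simp add: l_def field_simps)
    then have l: "inverse (real (Suc l)) < e" using n by linarith
    \<comment> \<open>The conjugate of \<open>g\<close> is trivial near \<open>x\<close>, on a ball
      whose size depends on \<open>V\<close>; stabilisation of the chain enlarges this ball to the
      fixed radius \<open>1/(L+1)\<close>.\<close>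
    have "h' (g (h z)) = z" if z: "dist z x < inverse (Suc l)" for z
    proof -
      have "z \<in> ball x e" using z l by (simp add: dist_commute)
      then have "h z \<in> V" using e(2) by blast
      then show ?thesis using fix_V h'(4) by simp
    qed
    then have "(\<lambda>z. h' (g (h z))) \<in> germ_stabiliser x l"
      using comp_in_K[OF h'(1) comp_in_K[OF g h(1)]] unfolding germ_stabiliser_def by blast
    then have stab: "(\<lambda>z. h' (g (h z))) \<in> germ_stabiliser x L" using L[of l] by (auto simp: l_def)
    have "dist u y \<le> diameter U"
      using diameter_bounded_bound[OF bounded_all u] y V(3) by blast
    then have "dist u y < d" using U by simp
    then have "dist (h' u) x < inverse (Suc L)" using d(2)[OF _ h'(1), of u y] by (simp add: h'(2))
    then have "h' (g (h (h' u))) = h' u" using stab unfolding germ_stabiliser_def by blast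
    then have "h (h' (g u)) = h (h' u)" by (simp add: h'(3))
    then show ?thesis by (simp add: h'(3))
  qed
  note fixes_U = this
  show ?thesis
    unfolding stable_action_def locally_quasi_analytic_def closure_action_def
  proof (intro exI[of _ d] conjI allI impI ballI d(1))
    fix U V g u
    assume UV: "open U \<and> U \<noteq> {} \<and> diameter U < d \<and> open V \<and> V \<noteq> {} \<and> V \<subseteq> U"
      and g: "g \<in> carrier K" "g ` V = V \<and> (\<forall>y\<in>V. g y = y)" and u: "u \<in> U"
    show "g u = u" by (rule fixes_U[of U V]) (use UV g u in auto)
  qed
qed

section \<open>Reduction of the theorem to the chain of germ stabilisers\<close>

lemma subgroup_discriminant: "subgroup (discriminant G \<phi> x) K"
proof (rule K.subgroupI)
  have mem: "g \<in> discriminant G \<phi> x \<longleftrightarrow> g \<in> carrier K \<and> g x = x" for g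
    by (simp add: discriminant_def stabilizer_def closure_action_def)
  show "discriminant G \<phi> x \<subseteq> carrier K" using mem by blast
  have "\<one>\<^bsub>K\<^esub> \<in> discriminant G \<phi> x" using K.one_closed by (simp add: mem K_one)
  then show "discriminant G \<phi> x \<noteq> {}" by blast
  show "inv\<^bsub>K\<^esub> g \<in> discriminant G \<phi> x" if g: "g \<in> discriminant G \<phi> x" for g
  proof -
    have gK: "g \<in> carrier K" "g x = x" using g mem by blast+
    then have "(inv\<^bsub>K\<^esub> g) x = x" using K_inv_apply(1)[OF gK(1), of x] by simp
    then show ?thesis using K.inv_closed[OF gK(1)] mem by blast
  qed
  show "g \<otimes>\<^bsub>K\<^esub> h \<in> discriminant G \<phi> x" if g: "g \<in> discriminant G \<phi> x" and h: "h \<in> discriminant G \<phi> x" for g h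
  proof -
    have "g \<in> carrier K" "g x = x" "h \<in> carrier K" "h x = x" using g h mem by blast+
    then show ?thesis using comp_in_K[of g h] by (simp add: mem K_mult)
  qed
qed

text \<open>\<open>D\<close> stands for whichever group has finite spectrum, the discriminant or all
  of \<open>K\<close>. It contains all germ stabilisers, so one exponent per level serves the whole
  chain.\<close>

lemma stable_if_spectrum_finite:
  assumes nilpotent: "virtually_fg_nilpotent G"
    and D: "subgroup D K" "discriminant G \<phi> x \<subseteq> D"
    and "finite P"
    and P: "\<And>N p. N \<in> open_normal_subgroups G \<phi> \<Longrightarrow> finite (rcosets\<^bsub>K\<lparr>carrier := D\<rparr>\<^esub> (N \<inter> D)) \<Longrightarrow>
      prime p \<Longrightarrow> p dvd order (K\<lparr>carrier := D\<rparr> Mod (N \<inter> D)) \<Longrightarrow> p \<in> P"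
  shows "stable_action G \<phi>"
proof -
  obtain N where N: "compact_filtration K N" "\<And>k. N k \<in> open_normal_subgroups G \<phi>"
    and N_small: "\<And>k g y. g \<in> N k \<Longrightarrow> dist (g y) y < inverse (Suc k)"
    and N_nbhd: "\<And>k. \<exists>d>0. \<forall>f\<in>carrier K. \<forall>h\<in>carrier K. (\<forall>y. dist (f y) (h y) < d) \<longrightarrow> inv\<^bsub>K\<^esub> f \<otimes>\<^bsub>K\<^esub> h \<in> N k"
    using small_open_normal_subgroups by blast
  interpret F: compact_filtration K N by (rule N(1))
  interpret D: group "K\<lparr>carrier := D\<rparr>" using D(1) by (rule K.subgroup_imp_group)
  have DK: "h \<in> carrier K" if "h \<in> D" for h using D(1) that by (rule subgroup.mem_carrier)
  have approx: "\<exists>g\<in>carrier G. inv\<^bsub>K\<^esub> (\<phi> g) \<otimes>\<^bsub>K\<^esub> f \<in> N k" if f: "f \<in> carrier K" for f k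
  proof -
    obtain d where d: "d > 0" "\<And>h h'. h \<in> carrier K \<Longrightarrow> h' \<in> carrier K \<Longrightarrow> \<forall>y. dist (h y) (h' y) < d \<Longrightarrow> inv\<^bsub>K\<^esub> h \<otimes>\<^bsub>K\<^esub> h' \<in> N k"
      using N_nbhd[of k] by blast
    obtain g where g: "g \<in> carrier G" "\<forall>y. dist (f y) (\<phi> g y) < d"
      using f d(1) unfolding carrier_K_iff by blast
    have "inv\<^bsub>K\<^esub> (\<phi> g) \<otimes>\<^bsub>K\<^esub> f \<in> N k"
      using d(2)[OF act_in_K[OF g(1)] f] g(2) by (simp add: dist_commute)
    then show ?thesis using g(1) by blast
  qed
  \<comment> \<open>The exponent is the order of the finite group
    \<open>D / (N k \<inter> D)\<close>, by Lagrange.\<close>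
  have spectrum: "\<exists>q>0. (\<forall>p. prime p \<longrightarrow> p dvd q \<longrightarrow> p \<in> P) \<and> (\<forall>h\<in>D. h [^]\<^bsub>K\<^esub> (q::nat) \<in> N k)" for k
  proof -
    define q where "q = order (K\<lparr>carrier := D\<rparr> Mod (N k \<inter> D))"
    have normal: "N k \<inter> D \<lhd> K\<lparr>carrier := D\<rparr>"
      using K.normal_Int_subgroup[OF D(1) F.normal_N[of k]] by (simp add: Int_commute)
    have fin: "finite (rcosets\<^bsub>K\<lparr>carrier := D\<rparr>\<^esub> (N k \<inter> D))" using D(1) by (rule F.finite_cosets)
    then have "q > 0"
      unfolding q_def order_def FactGroup_def
      using subgroup.subgroup_in_rcosets[OF normal_imp_subgroup[OF normal] D.is_group] by (auto simp: card_gt_0_iff)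
    moreover have "h [^]\<^bsub>K\<^esub> q \<in> N k" if "h \<in> D" for h
      using D.power_order_FactGroup[OF normal, of h] that unfolding q_def
      by (simp add: K.nat_pow_consistent[of _ _ D])
    ultimately show ?thesis using P[OF N(2) fin] unfolding q_def by blast
  qed
  have "F.cl (germ_stabiliser x l) \<subseteq> germ_stabiliser x l" for l
  proof
    fix g assume g: "g \<in> F.cl (germ_stabiliser x l)"
    then have gK: "g \<in> carrier K" by (simp add: F.cl_def)
    have "g y = y" if y: "dist y x < inverse (Suc l)" for y
    proof -
      have "dist (g y) y < e" if e: "e > 0" for e
      proof -
        obtain d where d: "d > 0" "\<And>y z f. dist y z < d \<Longrightarrow> f \<in> carrier K \<Longrightarrow> dist (f y) (f z) < e"
          using K_equicontinuous[OF e] by blast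
        obtain k where k: "inverse (real (Suc k)) < d" using reals_Archimedean[OF d(1)] by blast
        obtain a where a: "a \<in> germ_stabiliser x l" "inv\<^bsub>K\<^esub> a \<otimes>\<^bsub>K\<^esub> g \<in> N k"
          using g unfolding F.cl_def by blast
        have aK: "a \<in> carrier K" using a(1) by (rule germ_stabiliser_in_K)
        have "dist ((inv\<^bsub>K\<^esub> a) (g y)) y < d"
          using N_small[OF a(2), of y] k by (simp add: K_mult[OF K.inv_closed[OF aK] gK])
        then have "dist (a ((inv\<^bsub>K\<^esub> a) (g y))) (a y) < e" by (rule d(2)[OF _ aK])
        moreover have "a y = y" using a(1) y unfolding germ_stabiliser_def by blast
        ultimately show ?thesis by (simp add: K_inv_apply(2)[OF aK])
      qed
      then show ?thesis by (metis less_irrefl zero_less_dist_iff)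
    qed
    then show "g \<in> germ_stabiliser x l" using gK unfolding germ_stabiliser_def by blast
  qed
  moreover have "germ_stabiliser x l \<subseteq> D" for l using germ_stabiliser_discriminant D(2) by blast
  ultimately have chain: "F.pro_P_chain P (germ_stabiliser x)"
    unfolding F.pro_P_chain_def using subgroup_germ_stabiliser mono_germ_stabiliser spectrum by (meson subsetD)

  obtain H where H: "subgroup H G" "finite (rcosets H)" "finitely_generated_group (G\<lparr>carrier := H\<rparr>)"
    "nilpotent_group (G\<lparr>carrier := H\<rparr>)"
    using nilpotent unfolding virtually_fg_nilpotent_def by blast
  interpret H: group "G\<lparr>carrier := H\<rparr>" using H(1) by (rule G.subgroup_imp_group)
  interpret act: group_hom G K \<phi> by unfold_locales (rule act_hom)
  interpret actH: group_hom "G\<lparr>carrier := H\<rparr>" K \<phi>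
    using act_hom subgroup.mem_carrier[OF H(1)] by unfold_locales (auto simp: hom_def)
  have poly: "polycyclic_subgroup K (\<phi> ` H)"
    using actH.polycyclic_subgroup_image[OF H.fg_nilpotent_polycyclic[OF H(3,4)]] by simp
  have sub: "subgroup (\<phi> ` H) K" using H(1) by (rule act.subgroup_img_is_subgroup)
  define rep where "rep C = (SOME r. r \<in> carrier G \<and> C = H #> r)" for C
  have rep: "rep C \<in> carrier G" "C = H #> rep C" if C: "C \<in> rcosets H" for C
  proof -
    have "\<exists>r. r \<in> carrier G \<and> C = H #> r" using C by (auto simp: RCOSETS_def)
    then have "rep C \<in> carrier G \<and> C = H #> rep C" unfolding rep_def by (rule someI_ex)
    then show "rep C \<in> carrier G" "C = H #> rep C" by blast+
  qed
  define R where "R = rep ` (rcosets H)"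
  have R: "finite R" "R \<subseteq> carrier G" unfolding R_def using H(2) rep(1) by auto
  have cover: "\<exists>r\<in>R. g \<otimes> inv r \<in> H" if g: "g \<in> carrier G" for g
  proof -
    have C: "H #> g \<in> rcosets H" using g subgroup.subset[OF H(1)] by (rule G.rcosetsI[rotated])
    have "g \<in> H #> g" using g H(1) by (rule G.rcos_self)
    then have "g \<in> H #> rep (H #> g)" using rep(2)[OF C] by simp
    then have "g \<otimes> inv (rep (H #> g)) \<in> H"
      by (rule subgroup.rcos_module_imp[OF H(1) G.is_group rep(1)[OF C]])
    then show ?thesis using C unfolding R_def by blast
  qed
  have "\<exists>r\<in>\<phi> ` R. f \<otimes>\<^bsub>K\<^esub> inv\<^bsub>K\<^esub> r \<in> F.cl (\<phi> ` H)" if f: "f \<in> carrier K" for f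
  \<comment> \<open>Approximating \<open>f\<close> by some \<open>\<phi> g\<close> selects a
    representative \<open>r\<close> that may vary with the level. As \<open>R\<close> is finite and
    the \<open>N k\<close> decrease, failure of each \<open>r\<close> at its own level
    \<open>m r\<close> contradicts the approximation at the largest of these levels.\<close>
  proof (rule ccontr)
    assume contra: "\<not> ?thesis"
    have RK: "\<phi> r \<in> carrier K" if "r \<in> R" for r using that R(2) act_in_K by blast
    have HK: "\<phi> h \<in> carrier K" if "h \<in> H" for h using act_in_K[OF subgroup.mem_carrier[OF H(1) that]] .
    have "\<exists>k. \<forall>h\<in>H. inv\<^bsub>K\<^esub> (\<phi> h) \<otimes>\<^bsub>K\<^esub> (f \<otimes>\<^bsub>K\<^esub> inv\<^bsub>K\<^esub> (\<phi> r)) \<notin> N k" if r: "r \<in> R" for r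
    proof -
      have "f \<otimes>\<^bsub>K\<^esub> inv\<^bsub>K\<^esub> (\<phi> r) \<in> carrier K" using f RK[OF r] by simp
      then show ?thesis using contra r unfolding F.cl_def by blast
    qed
    then obtain m where m: "\<And>r h. r \<in> R \<Longrightarrow> h \<in> H \<Longrightarrow> inv\<^bsub>K\<^esub> (\<phi> h) \<otimes>\<^bsub>K\<^esub> (f \<otimes>\<^bsub>K\<^esub> inv\<^bsub>K\<^esub> (\<phi> r)) \<notin> N (m r)"
      by metis
    define k where "k = Max (insert 0 (m ` R))"
    obtain g where g: "g \<in> carrier G" "inv\<^bsub>K\<^esub> (\<phi> g) \<otimes>\<^bsub>K\<^esub> f \<in> N k" using approx[OF f] by blast
    obtain r where r: "r \<in> R" "g \<otimes> inv r \<in> H" using cover[OF g(1)] by blast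
    have rG: "r \<in> carrier G" using r R by blast
    have "m r \<le> k" unfolding k_def using r(1) R(1) by (intro Max_ge) auto
    then have "inv\<^bsub>K\<^esub> (\<phi> g) \<otimes>\<^bsub>K\<^esub> f \<in> N (m r)" using g(2) F.N_antimono by blast
    then have "\<phi> r \<otimes>\<^bsub>K\<^esub> (inv\<^bsub>K\<^esub> (\<phi> g) \<otimes>\<^bsub>K\<^esub> f) \<otimes>\<^bsub>K\<^esub> inv\<^bsub>K\<^esub> (\<phi> r) \<in> N (m r)"
      by (rule normal.inv_op_closed2[OF F.normal_N RK[OF r(1)]])
    moreover have "inv\<^bsub>K\<^esub> (\<phi> (g \<otimes> inv r)) = \<phi> r \<otimes>\<^bsub>K\<^esub> inv\<^bsub>K\<^esub> (\<phi> g)"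
      using g(1) rG by (simp add: K.inv_mult_group)
    ultimately show False using m[OF r] g(1) f RK[OF r(1)] act_in_K by (simp add: K.m_assoc)
  qed
  then obtain L where "\<forall>l\<ge>L. germ_stabiliser x l \<subseteq> germ_stabiliser x L"
    using F.virtually_polycyclic_pro_P_chain_stabilises[OF poly sub \<open>finite P\<close> chain, of "\<phi> ` R"] R act_in_K
    by blast
  then show ?thesis using stable_if_germ_stabilisers_stabilise by blast
qed

end

theorem theorem1p12:
  fixes G :: "('g, 'm) monoid_scheme"
    and \<phi> :: "'g \<Rightarrow> 'x::metric_space \<Rightarrow> 'x"
    and x :: 'x
  assumes "nilpotent_cantor_action G \<phi>"
  shows "(finite (prime_spectrum (steinitz_discriminant G \<phi> x)) \<longrightarrow> stable_action G \<phi>) \<and>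
         (finite (prime_spectrum (steinitz_closure_group G \<phi>)) \<longrightarrow> stable_action G \<phi>)"
proof -
  interpret equicontinuous_cantor_action G \<phi>
    using assms by unfold_locales (simp_all add: nilpotent_cantor_action_def)
  have nilpotent: "virtually_fg_nilpotent G" using assms by (simp add: nilpotent_cantor_action_def)
  have order_pos: "order (K\<lparr>carrier := D\<rparr> Mod (N \<inter> D)) > 0"
    if D: "subgroup D K"
      and fin: "finite (rcosets\<^bsub>K\<lparr>carrier := D\<rparr>\<^esub> (N \<inter> D))" for D N
  proof -
    have "rcosets\<^bsub>K\<lparr>carrier := D\<rparr>\<^esub> (N \<inter> D) \<noteq> {}"
      using subgroup.one_closed[OF D] by (auto simp: RCOSETS_def)
    then show ?thesis using fin by (simp add: order_def FactGroup_def card_gt_0_iff)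
  qed
  show ?thesis
  proof (intro conjI impI)
    assume fin: "finite (prime_spectrum (steinitz_discriminant G \<phi> x))"
    show "stable_action G \<phi>"
    proof (rule stable_if_spectrum_finite[OF nilpotent subgroup_discriminant subset_refl fin])
      fix N p
      let ?q = "order (K\<lparr>carrier := discriminant G \<phi> x\<rparr> Mod (N \<inter> discriminant G \<phi> x))"
      assume N: "N \<in> open_normal_subgroups G \<phi>"
        "finite (rcosets\<^bsub>K\<lparr>carrier := discriminant G \<phi> x\<rparr>\<^esub> (N \<inter> discriminant G \<phi> x))"
        and p: "prime p" "p dvd ?q"
      show "p \<in> prime_spectrum (steinitz_discriminant G \<phi> x)"
        unfolding steinitz_discriminant_def Let_def
        by (rule prime_in_spectrum[OF _ p order_pos[OF subgroup_discriminant N(2)]]) (use N in blast)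
    qed
  next
    assume fin: "finite (prime_spectrum (steinitz_closure_group G \<phi>))"
    show "stable_action G \<phi>"
    \<comment> \<open>The second claim takes the whole group for \<open>D\<close>, so that its own
      spectrum bounds the primes directly.\<close>
    proof (rule stable_if_spectrum_finite[OF nilpotent K.subgroup_self subgroup.subset[OF subgroup_discriminant] fin])
      fix N p
      assume N: "N \<in> open_normal_subgroups G \<phi>"
        "finite (rcosets\<^bsub>K\<lparr>carrier := carrier K\<rparr>\<^esub> (N \<inter> carrier K))"
        and p: "prime p" "p dvd order (K\<lparr>carrier := carrier K\<rparr> Mod (N \<inter> carrier K))"
      have "N \<lhd> K" using N by (simp add: open_normal_subgroups_def)
      then have NK: "N \<inter> carrier K = N" using normal_imp_subgroup subgroup.subset by blast
      show "p \<in> prime_spectrum (steinitz_closure_group G \<phi>)"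
        unfolding steinitz_closure_group_def
        by (rule prime_in_spectrum[OF _ p order_pos[OF K.subgroup_self N(2)]]) (use N NK in auto)
    qed
  qed
qed

end
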